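(* Let $d\ge 2$ be fixed. Then for every $n$ there exists an $n$-point set $G_{\mathrm s}\subset\mathbb{R}^d$ such that for every line $\ell\subset\mathbb{R}^d$ there exists a halfspace containing $\ell$ and containing at most $\frac{2n}{d+2}+o(n)$ points of $G_{\mathrm s}$. (Here the $o(n)$ term is a function of $n$ and $d$ only, independent of $\ell$: for each fixed $d$ it is a function $g_d(n)$ with $g_d(n)/n\to 0$ as $n\to\infty$.)
   Context: Halfspaces are closed Euclidean halfspaces of $\mathbb{R}^d$. A line is a $1$-dimensional affine subspace. *)

theory Defs
  imports "HOL-Analysis.Analysis"
begin

definition line :: "'a::euclidean_space set \<Rightarrow> bool" where
  "line L \<longleftrightarrow> affine L \<and> aff_dim L = 1"

text \<open>The normal vector is required to be nonzero, so neither the empty set nor the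
  whole space is a halfspace.\<close>

definition closed_halfspace :: "'a::euclidean_space set \<Rightarrow> bool" where
  "closed_halfspace H \<longleftrightarrow> (\<exists>a b. a \<noteq> 0 \<and> H = {x. a \<bullet> x \<le> b})"

end

theory Submission
  imports Defs
begin

text \<open>The point set is a stretched grid: from a grid \<open>G\<close> in dimension \<open>e\<close> one passes to
  \<open>G \<times> {K, K^2, ..., K^m}\<close> with \<open>K\<close> huge compared with \<open>G\<close>. The new coordinate of a line \<open>\<ell>\<close>
  is an affine function with a root splitting \<open>\<ell>\<close> into a positive and a negative ray. A
  halfspace containing the projection of the positive ray yields a halfspace containing \<open>\<ell>\<close> that
  avoids the layers above a threshold, a fraction \<open>1 - \<alpha>\<close> of all layers; one containing the
  projection of the negative ray yields a halfspace containing \<open>\<ell>\<close> and also these top layers. If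
  \<open>A\<close> and \<open>A'\<close> are the fractions of \<open>G\<close> cut off by best halfspaces through the two projected
  rays, then \<open>\<ell>\<close> lies in a halfspace with a fraction at most \<open>min (\<alpha> A) (1 - \<alpha> + \<alpha> A')\<close>, which is
  at most \<open>2 / (e + 3)\<close> because \<open>(e + 1) A + 2 A' \<le> 2\<close>. The latter inequality for complementary
  rays is proved by induction on \<open>e\<close>, all inequalities holding up to an error of order \<open>1 / m\<close>.\<close>

section \<open>Bounded affine functionals along a part of a line, and the depth they define\<close>

text \<open>Points and affine functionals are functions on indices \<open>0, ..., e\<close>; coordinate \<open>0\<close> of a
  point is \<open>1\<close>. A line is \<open>\<lambda>t. p + t v\<close> with \<open>p 0 = 1\<close> and \<open>v 0 = 0\<close>; \<open>v = 0\<close> is allowed, since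
  projections of lines may degenerate to points. Coefficients are bounded by \<open>B\<close> so that the
  stretching factor can be chosen uniformly for all lines, and only points with value at least
  \<open>1\<close> rather than positive ones count as excluded, to leave room for perturbations.\<close>

definition dot :: "nat \<Rightarrow> (nat \<Rightarrow> real) \<Rightarrow> (nat \<Rightarrow> real) \<Rightarrow> real" where
  "dot e a x = (\<Sum>i\<le>e. a i * x i)"

definition feasible ::
    "nat \<Rightarrow> real \<Rightarrow> (nat \<Rightarrow> real) \<Rightarrow> (nat \<Rightarrow> real) \<Rightarrow> real set \<Rightarrow> (nat \<Rightarrow> real) \<Rightarrow> bool" where
  "feasible e B p v S a \<longleftrightarrow>
    (\<forall>i\<le>e. \<bar>a i\<bar> \<le> B) \<and> (\<forall>t\<in>S. dot e a p + t * dot e a v \<le> 0)"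

definition cnt :: "(nat \<Rightarrow> real) set \<Rightarrow> nat \<Rightarrow> (nat \<Rightarrow> real) \<Rightarrow> nat" where
  "cnt G e a = card {g \<in> G. dot e a g < 1}"

definition depth ::
    "(nat \<Rightarrow> real) set \<Rightarrow> nat \<Rightarrow> real \<Rightarrow> (nat \<Rightarrow> real) \<Rightarrow> (nat \<Rightarrow> real) \<Rightarrow> real set \<Rightarrow> real" where
  "depth G e B p v S = real (LEAST k. \<exists>a. feasible e B p v S a \<and> cnt G e a = k)"

lemma depth_le_cnt: "feasible e B p v S a \<Longrightarrow> depth G e B p v S \<le> real (cnt G e a)"
  unfolding depth_def of_nat_le_iff by (rule Least_le) blast

lemma depth_attained:
  assumes "B \<ge> 0"
  obtains a where "feasible e B p v S a" "real (cnt G e a) = depth G e B p v S"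
proof -
  have "feasible e B p v S (\<lambda>_. 0)"
    using assms by (simp add: feasible_def dot_def)
  then have "\<exists>k. \<exists>a. feasible e B p v S a \<and> cnt G e a = k" by blast
  from LeastI_ex[OF this] show thesis
    using that unfolding depth_def by auto
qed

lemma depth_mono:
  assumes "B \<ge> 0" "S \<subseteq> T"
  shows "depth G e B p v S \<le> depth G e B p v T"
proof -
  obtain a where a: "feasible e B p v T a" "real (cnt G e a) = depth G e B p v T"
    using depth_attained[OF assms(1)] by blast
  have "feasible e B p v S a" using a(1) assms(2) unfolding feasible_def by blast
  from depth_le_cnt[OF this, of G] show ?thesis unfolding a(2) .
qed

lemma dot_line: "dot e a (\<lambda>i. p i + c * v i) = dot e a p + c * dot e a v"
  unfolding dot_def sum_distrib_left sum.distrib[symmetric]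
  by (intro sum.cong refl) (simp add: algebra_simps)

lemma dot_scale: "dot e a (\<lambda>i. c * v i) = c * dot e a v"
  unfolding dot_def sum_distrib_left by (intro sum.cong refl) simp

lemma dot_comb: "dot e (\<lambda>i. c * a i + u i) x = c * dot e a x + dot e u x"
  unfolding dot_def sum_distrib_left sum.distrib[symmetric]
  by (intro sum.cong refl) (simp add: algebra_simps)

lemma dot_Suc: "dot (Suc e) (a(Suc e := c)) x = dot e a x + c * x (Suc e)"
  by (simp add: dot_def)

lemma dot_cong: "(\<And>i. i \<le> e \<Longrightarrow> x i = y i) \<Longrightarrow> dot e a x = dot e a y"
  by (simp add: dot_def)

lemma dot_upd [simp]: "dot e a (g(Suc e := z)) = dot e a g"
  by (rule dot_cong) auto

lemma abs_dot_le:
  assumes "\<And>i. i \<le> e \<Longrightarrow> \<bar>a i\<bar> \<le> B" "\<And>i. i \<le> e \<Longrightarrow> \<bar>x i\<bar> \<le> X" "B \<ge> 0"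
  shows "\<bar>dot e a x\<bar> \<le> (real e + 1) * B * X"
proof -
  have "\<bar>dot e a x\<bar> \<le> (\<Sum>i\<le>e. \<bar>a i * x i\<bar>)"
    unfolding dot_def by (rule sum_abs)
  also have "\<dots> \<le> (\<Sum>i\<le>e. B * X)"
    using assms by (intro sum_mono) (auto simp: abs_mult intro!: mult_mono)
  finally show ?thesis by (simp add: algebra_simps)
qed

text \<open>Feasibility sees only the points \<open>p + t v\<close> with \<open>t\<close> in
  \<open>S\<close>, so the base point may slide along the line and the direction may be rescaled.
  The new parameter \<open>s\<close> satisfies \<open>t = c + d * s\<close>.\<close>

lemma depth_reparam:
  assumes "d \<noteq> 0"
  shows "depth G e B p v S =
    depth G e B (\<lambda>i. p i + c * v i) (\<lambda>i. d * v i) {s. c + d * s \<in> S}"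
proof -
  have ball: "(\<forall>t\<in>S. P t) \<longleftrightarrow> (\<forall>s\<in>{s. c + d * s \<in> S}. P (c + d * s))" for P
  proof
    assume *: "\<forall>s\<in>{s. c + d * s \<in> S}. P (c + d * s)"
    show "\<forall>t\<in>S. P t"
    proof
      fix t assume "t \<in> S"
      moreover have "c + d * ((t - c) / d) = t" using assms by simp
      ultimately show "P t" using * by (metis mem_Collect_eq)
    qed
  qed auto
  have "feasible e B p v S a \<longleftrightarrow>
      feasible e B (\<lambda>i. p i + c * v i) (\<lambda>i. d * v i) {s. c + d * s \<in> S} a" for a
    unfolding feasible_def dot_line dot_scale ball[of "\<lambda>t. dot e a p + t * dot e a v \<le> 0"]
    by (simp only: distrib_right add.assoc mult.assoc mult.left_commute)
  then show ?thesis by (simp add: depth_def)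
qed

section \<open>The inequalities carried through the induction\<close>

text \<open>Depths are numbers of points among \<open>m ^ e\<close>, so \<open>(2 * m + C) * m ^ (e - 1)\<close> is
  \<open>2 + C / m\<close> times the total.\<close>

definition line_bounds ::
    "nat \<Rightarrow> real \<Rightarrow> real \<Rightarrow> nat \<Rightarrow> (nat \<Rightarrow> real) set \<Rightarrow> real \<Rightarrow> (nat \<Rightarrow> real) \<Rightarrow> (nat \<Rightarrow> real) \<Rightarrow> bool" where
  "line_bounds e c C m G B p v \<longleftrightarrow>
    (\<forall>t. (real e + 1) * depth G e B p v {t} \<le> (m + C) * real m ^ (e - 1)) \<and>
    c * depth G e B p v UNIV \<le> (2 * m + C) * real m ^ (e - 1) \<and>
    (\<forall>q. (real e + 1) * depth G e B p v {q..} + 2 * depth G e B p v {..q}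
        \<le> (2 * m + C) * real m ^ (e - 1)) \<and>
    (\<forall>q. (real e + 1) * depth G e B p v {..q} + 2 * depth G e B p v {q..}
        \<le> (2 * m + C) * real m ^ (e - 1))"

text \<open>A negative \<open>d\<close> exchanges upper and lower rays. Both orientations occur in
  \<open>line_bounds\<close>, so a line may be normalized and oriented before its bounds are
  proved.\<close>

lemma line_bounds_reparam:
  assumes d: "d \<noteq> 0"
    and b: "line_bounds e c C m G B (\<lambda>i. p i + k * v i) (\<lambda>i. d * v i)"
  shows "line_bounds e c C m G B p v"
proof -
  note r = depth_reparam[OF d, of G e B p v _ k]
  have 1: "{s. k + d * s \<in> {t}} = {(t - k) / d}" for t
    using d by (auto simp: field_simps)
  have 2: "{s. k + d * s \<in> {q..}} = (if d > 0 then {(q - k) / d..} else {..(q - k) / d})" for q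
    using d by (auto simp: field_simps)
  have 3: "{s. k + d * s \<in> {..q}} = (if d > 0 then {..(q - k) / d} else {(q - k) / d..})" for q
    using d by (auto simp: field_simps)
  show ?thesis
    using b unfolding line_bounds_def r 1 2 3 by simp
qed

text \<open>The constant \<open>c\<close> for whole lines is separate because it starts low: in
  dimension 1 a line fills the space, every point of the grid is counted and only
  \<open>c = 2\<close> is possible, whereas the step produces \<open>e + 3\<close> in dimension
  \<open>e + 1\<close>.\<close>

definition grid_bounds :: "nat \<Rightarrow> real \<Rightarrow> real \<Rightarrow> nat \<Rightarrow> (nat \<Rightarrow> real) set \<Rightarrow> real \<Rightarrow> bool" where
  "grid_bounds e c C m G B \<longleftrightarrow>
    finite G \<and> card G = m ^ e \<and> (\<forall>g\<in>G. g 0 = 1 \<and> (\<forall>i>e. g i = 0)) \<and> B \<ge> 0 \<and>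
    (\<forall>p v. p 0 = 1 \<longrightarrow> v 0 = 0 \<longrightarrow> line_bounds e c C m G B p v)"

section \<open>Functionals of one coordinate and the one-dimensional grid\<close>

definition coord_fun :: "nat \<Rightarrow> real \<Rightarrow> real \<Rightarrow> nat \<Rightarrow> real" where
  "coord_fun i c0 c1 = (\<lambda>k. if k = 0 then c0 else if k = i then c1 else 0)"

lemma dot_coord_fun:
  assumes "i \<le> e" "i \<noteq> 0"
  shows "dot e (coord_fun i c0 c1) x = c0 * x 0 + c1 * x i"
proof -
  have "dot e (coord_fun i c0 c1) x = (\<Sum>k\<in>{0,i}. coord_fun i c0 c1 k * x k)"
    unfolding dot_def using assms by (intro sum.mono_neutral_right) (auto simp: coord_fun_def)
  then show ?thesis using assms by (simp add: coord_fun_def)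
qed

lemma abs_coord_fun_le: "\<bar>c0\<bar> \<le> D \<Longrightarrow> \<bar>c1\<bar> \<le> D \<Longrightarrow> \<bar>coord_fun i c0 c1 k\<bar> \<le> D"
  by (auto simp: coord_fun_def)

text \<open>On the grid \<open>1, ..., m\<close> a set lying below \<open>y\<close> is handled by
  the functional \<open>x - y\<close>, a set lying above \<open>y\<close> by \<open>y - x\<close>.
  Since values below \<open>1\<close> are counted, the two counts overlap in at most two points, so
  complementary rays have depths of sum at most \<open>m + 2\<close>.\<close>

lemma grid_bounds_base:
  assumes m: "m \<ge> 1"
  shows "\<exists>G. grid_bounds 1 2 4 m G (real m + 1)"
proof -
  define G where "G = (\<lambda>j. coord_fun 1 1 (real j)) ` {1..m}"
  have inj: "inj_on (\<lambda>j. coord_fun 1 1 (real j)) {1..m}"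
  proof (rule inj_onI)
    fix x y assume "coord_fun 1 1 (real x) = coord_fun 1 1 (real y)"
    then have "coord_fun 1 1 (real x) 1 = coord_fun 1 1 (real y) 1" by simp
    then show "x = y" by (simp add: coord_fun_def)
  qed
  have fin: "finite G" and card: "card G = m"
    unfolding G_def using card_image[OF inj] by auto
  have dot1: "dot 1 a x = a 0 * x 0 + a 1 * x 1" for a x
    by (simp add: dot_def)
  have dotc: "dot 1 a (coord_fun 1 1 x) = a 0 + a 1 * x" for a x
    unfolding dot1 by (simp add: coord_fun_def)
  have cnt1: "cnt G 1 a = card {j\<in>{1..m}. a 0 + a 1 * real j < 1}" for a
  proof -
    have sub: "{j\<in>{1..m}. a 0 + a 1 * real j < 1} \<subseteq> {1..m}" by auto
    have "{g \<in> G. dot 1 a g < 1} =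
        (\<lambda>j. coord_fun 1 1 (real j)) ` {j\<in>{1..m}. a 0 + a 1 * real j < 1}"
      unfolding G_def dotc[symmetric] by auto
    then show ?thesis
      unfolding cnt_def by (simp only: card_image[OF inj_on_subset[OF inj sub]])
  qed
  have "line_bounds 1 2 4 m G (real m + 1) p v" if p: "p 0 = 1" and v: "v 0 = 0" for p v
  proof -
    define D where "D S = depth G 1 (real m + 1) p v S" for S
    have le: "D S \<le> m" for S
    proof -
      obtain a where "real (cnt G 1 a) = D S"
        unfolding D_def using depth_attained[of "real m + 1" 1 p v S G] by auto
      then show ?thesis
        using card_mono[OF fin, of "{g \<in> G. dot 1 a g < 1}"] card by (auto simp: cnt_def)
    qed
    have low: "D S \<le> card {j\<in>{1..m}. real j < y + 1}"
      if S: "\<And>t. t \<in> S \<Longrightarrow> p 1 + t * v 1 \<le> y" for S y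
    proof (cases "y > m")
      case True
      then have "{j\<in>{1..m}. real j < y + 1} = {1..m}" by auto
      then show ?thesis using le by simp
    next
      case False
      \<comment> \<open>Clipping at \<open>0\<close> keeps the constant term within
        \<open>m + 1\<close>; for \<open>y < 0\<close> the clipped functional counts no grid
        point.\<close>
      define a where "a = coord_fun 1 (- max 0 y) 1"
      have "p 1 - max 0 y + t * v 1 \<le> 0" if "t \<in> S" for t
        using S[OF that] by simp
      then have "feasible 1 (real m + 1) p v S a"
        using m p v False unfolding feasible_def a_def dot1
        by (auto simp: coord_fun_def)
      then have "D S \<le> cnt G 1 a" unfolding D_def by (rule depth_le_cnt)
      also have "\<dots> \<le> card {j\<in>{1..m}. real j < y + 1}"
        unfolding cnt1 of_nat_le_iff by (rule card_mono) (auto simp: a_def coord_fun_def)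
      finally show ?thesis .
    qed
    have up: "D S \<le> card {j\<in>{1..m}. real j > y - 1}"
      if S: "\<And>t. t \<in> S \<Longrightarrow> p 1 + t * v 1 \<ge> y" for S y
    proof (cases "y \<le> 1")
      case True
      then have "{j\<in>{1..m}. real j > y - 1} = {1..m}" by auto
      then show ?thesis using le by simp
    next
      case False
      \<comment> \<open>Likewise, for \<open>y > m + 1\<close> the clipped functional counts no grid
        point.\<close>
      define a where "a = coord_fun 1 (min y (real m + 1)) (-1)"
      have "min y (real m + 1) - p 1 - t * v 1 \<le> 0" if "t \<in> S" for t
        using S[OF that] by simp
      then have "feasible 1 (real m + 1) p v S a"
        using m p v False unfolding feasible_def a_def dot1
        by (auto simp: coord_fun_def)
      then have "D S \<le> cnt G 1 a" unfolding D_def by (rule depth_le_cnt)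
      also have "\<dots> \<le> card {j\<in>{1..m}. real j > y - 1}"
        unfolding cnt1 of_nat_le_iff by (rule card_mono) (auto simp: a_def coord_fun_def)
      finally show ?thesis .
    qed
    have tot: "card {j\<in>{1..m}. real j < y + 1} + card {j\<in>{1..m}. real j > y - 1} \<le> m + 2" for y
    proof -
      let ?A = "{j\<in>{1..m}. real j < y + 1}" and ?B = "{j\<in>{1..m}. real j > y - 1}"
      have "?A \<inter> ?B \<subseteq> {nat \<lfloor>y\<rfloor>, nat \<lfloor>y\<rfloor> + 1}"
      proof
        fix j assume "j \<in> ?A \<inter> ?B"
        then have "real j < y + 1" "real j > y - 1" by auto
        then have "int j = \<lfloor>y\<rfloor> \<or> int j = \<lfloor>y\<rfloor> + 1" by linarith
        then show "j \<in> {nat \<lfloor>y\<rfloor>, nat \<lfloor>y\<rfloor> + 1}" by auto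
      qed
      then have "card (?A \<inter> ?B) \<le> card {nat \<lfloor>y\<rfloor>, nat \<lfloor>y\<rfloor> + 1}"
        by (intro card_mono) auto
      then have "card (?A \<inter> ?B) \<le> 2" by simp
      moreover have "card (?A \<union> ?B) \<le> card {1..m}" by (intro card_mono) auto
      ultimately show ?thesis using card_Un_Int[of ?A ?B] by simp
    qed
    have rays: "D {q..} + D {..q} \<le> m + 2" for q
    proof (cases "v 1 \<ge> 0")
      case True
      have "D {q..} \<le> card {j\<in>{1..m}. real j > (p 1 + q * v 1) - 1}"
        by (rule up) (use True in \<open>auto intro: mult_right_mono\<close>)
      moreover have "D {..q} \<le> card {j\<in>{1..m}. real j < (p 1 + q * v 1) + 1}"
        by (rule low) (use True in \<open>auto intro: mult_right_mono\<close>)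
      ultimately show ?thesis using tot[of "p 1 + q * v 1"] by linarith
    next
      case False
      have "D {..q} \<le> card {j\<in>{1..m}. real j > (p 1 + q * v 1) - 1}"
        by (rule up) (use False in \<open>auto intro: mult_right_mono_neg\<close>)
      moreover have "D {q..} \<le> card {j\<in>{1..m}. real j < (p 1 + q * v 1) + 1}"
        by (rule low) (use False in \<open>auto intro: mult_right_mono_neg\<close>)
      ultimately show ?thesis using tot[of "p 1 + q * v 1"] by linarith
    qed
    have pt: "2 * D {t} \<le> m + 2" for t
    proof -
      have "D {t} \<le> D {t..}" "D {t} \<le> D {..t}"
        unfolding D_def by (auto intro!: depth_mono)
      then show ?thesis using rays[of t] by linarith
    qed
    show ?thesis
      unfolding line_bounds_def D_def[symmetric]
    proof (intro conjI allI)
      fix t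
      show "(real 1 + 1) * D {t} \<le> (real m + 4) * real m ^ (1 - 1)" using pt[of t] by simp
      show "(real 1 + 1) * D {t..} + 2 * D {..t} \<le> (2 * real m + 4) * real m ^ (1 - 1)"
        using rays[of t] by simp
      show "(real 1 + 1) * D {..t} + 2 * D {t..} \<le> (2 * real m + 4) * real m ^ (1 - 1)"
        using rays[of t] by simp
    qed (use le[of UNIV] in simp)
  qed
  then show ?thesis
    unfolding grid_bounds_def using fin card m
    by (intro exI[of _ G]) (auto simp: G_def coord_fun_def)
qed

section \<open>The stretched grid, its layers, and functionals lifted to it\<close>

text \<open>Divided by \<open>m\<close>, this is the fraction \<alpha> belonging to the threshold
  \<open>r\<close>.\<close>

definition layers :: "nat \<Rightarrow> real \<Rightarrow> real \<Rightarrow> nat" where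
  "layers m K r = card {j\<in>{1..m}. K ^ j \<le> r}"

lemma layers_le: "layers m K r \<le> m"
proof -
  have "layers m K r \<le> card {1..m}"
    unfolding layers_def by (intro card_mono) auto
  then show ?thesis by simp
qed

text \<open>Successive layers differ by the factor \<open>K\<close>, so moving the threshold by this
  factor costs at most one layer. Lifted functionals therefore need to match a threshold only up to
  a factor \<open>K\<close>.\<close>

lemma card_layers_below:
  assumes "K > 0"
  shows "card {j\<in>{1..m}. K ^ j < r * K} \<le> layers m K r + 1"
proof -
  \<comment> \<open>The index \<open>j - 1\<close> is a layer below the threshold unless
    \<open>j = 1\<close>, whence the extra element.\<close>
  have "{j\<in>{1..m}. K ^ j < r * K} \<subseteq> insert 1 (Suc ` {j\<in>{1..m}. K ^ j \<le> r})"
  proof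
    fix j assume j: "j \<in> {j\<in>{1..m}. K ^ j < r * K}"
    show "j \<in> insert 1 (Suc ` {j\<in>{1..m}. K ^ j \<le> r})"
    proof (cases "j = 1")
      case False
      with j obtain i where i: "j = Suc i" "i \<ge> 1" by (cases j) auto
      with j assms have "K ^ i \<le> r" by (simp add: mult.commute)
      with i j show ?thesis by auto
    qed simp
  qed
  then have "card {j\<in>{1..m}. K ^ j < r * K} \<le> card (insert 1 (Suc ` {j\<in>{1..m}. K ^ j \<le> r}))"
    by (intro card_mono) auto
  also have "\<dots> \<le> card (Suc ` {j\<in>{1..m}. K ^ j \<le> r}) + 1"
    by (simp add: card_insert_if)
  finally show ?thesis
    by (simp add: card_image layers_def)
qed

lemma layers_le_divide:
  assumes "K > 0"
  shows "layers m K r \<le> card {j\<in>{1..m}. K ^ j \<le> r / K} + 1"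
proof -
  have "{j\<in>{1..m}. K ^ j \<le> r} \<subseteq> insert 1 (Suc ` {j\<in>{1..m}. K ^ j \<le> r / K})"
  proof
    fix j assume j: "j \<in> {j\<in>{1..m}. K ^ j \<le> r}"
    show "j \<in> insert 1 (Suc ` {j\<in>{1..m}. K ^ j \<le> r / K})"
    proof (cases "j = 1")
      case False
      with j obtain i where i: "j = Suc i" "i \<ge> 1" by (cases j) auto
      with j assms have "K ^ i \<le> r / K" by (simp add: field_simps)
      with i j show ?thesis by auto
    qed simp
  qed
  then have "layers m K r \<le> card (insert 1 (Suc ` {j\<in>{1..m}. K ^ j \<le> r / K}))"
    unfolding layers_def by (intro card_mono) auto
  also have "\<dots> \<le> card (Suc ` {j\<in>{1..m}. K ^ j \<le> r / K}) + 1"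
    by (simp add: card_insert_if)
  finally show ?thesis by (simp add: card_image)
qed

lemma card_layers_above:
  assumes "K > 0"
  shows "card {j\<in>{1..m}. K ^ j > r / K} + layers m K r \<le> m + 1"
proof -
  let ?A = "{j\<in>{1..m}. K ^ j > r / K}" and ?B = "{j\<in>{1..m}. K ^ j \<le> r / K}"
  have "card (?A \<union> ?B) = card ?A + card ?B" by (rule card_Un_disjoint) auto
  moreover have "?A \<union> ?B = {1..m}" by auto
  ultimately have "card ?A + card ?B = m" by (metis card_atLeastAtMost diff_Suc_1)
  then show ?thesis using layers_le_divide[OF assms, of m r] by linarith
qed

definition stretch :: "nat \<Rightarrow> nat \<Rightarrow> real \<Rightarrow> (nat \<Rightarrow> real) set \<Rightarrow> (nat \<Rightarrow> real) set" where
  "stretch e m K G = (\<lambda>(g, j). g(Suc e := K ^ j)) ` (G \<times> {1..m})"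

lemma finite_stretch: "finite G \<Longrightarrow> finite (stretch e m K G)"
  by (simp add: stretch_def)

lemma card_stretch:
  assumes supp: "\<And>g. g \<in> G \<Longrightarrow> g (Suc e) = 0" and K: "K > 1"
  shows "card (stretch e m K G) = card G * m"
proof -
  have "inj_on (\<lambda>(g, j). g(Suc e := K ^ j)) (G \<times> {1..m})"
  proof (rule inj_onI, clarify)
    fix g h i j
    assume gh: "g \<in> G" "h \<in> G" and eq: "g(Suc e := K ^ i) = h(Suc e := K ^ j)"
    have "g = (g(Suc e := K ^ i))(Suc e := 0)" using supp[OF gh(1)] by auto
    also have "\<dots> = h" unfolding eq using supp[OF gh(2)] by auto
    finally have "g = h" .
    moreover have "K ^ i = K ^ j" using fun_cong[OF eq, of "Suc e"] by simp
    then have "i = j" using power_inject_exp[OF K] by simp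
    ultimately show "g = h \<and> i = j" by simp
  qed
  then show ?thesis by (simp add: stretch_def card_image card_cartesian_product)
qed

text \<open>\<open>X\<close> bounds the coordinates of \<open>G\<close> and \<open>B\<close> the
  coefficients of functionals on \<open>G\<close>. A value of at least \<open>1\<close> multiplied
  by \<open>M\<close> survives a perturbation of size \<open>3 * X + 1\<close>. \<open>T\<close>
  bounds \<open>M\<close> times the slope of a functional along a direction with entries at most
  \<open>1\<close>. The conditions on \<open>K\<close> make it exceed the coefficients of lifted
  functionals (\<open>K1\<close>), their values on \<open>G\<close> (\<open>K2\<close>), the slopes
  and changes of threshold (\<open>K3\<close>) and the shifts that occur for lines near the old
  space (\<open>K4\<close>).\<close>

locale stretching =
  fixes e m :: nat and G :: "(nat \<Rightarrow> real) set" and B X M T K :: real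
  assumes e: "e \<ge> 1" and fin: "finite G"
    and coord0: "\<And>g. g \<in> G \<Longrightarrow> g 0 = 1"
    and coord_le: "\<And>g i. g \<in> G \<Longrightarrow> i \<le> e \<Longrightarrow> \<bar>g i\<bar> \<le> X"
    and X: "X \<ge> 1" and B: "B \<ge> 2 * X"
    and M: "M = 3 * X + 2" and T: "T = M * (real e + 1) * B"
    and K1: "M * B + 2 * X \<le> K" and K2: "T * X + 3 * X + 1 \<le> K" and K3: "M * T + T + 2 * M \<le> K"
    and K4: "8 * X \<le> K"
begin

abbreviation "G2 \<equiv> stretch e m K G"
abbreviation "D \<equiv> \<lambda>p v S. depth G2 (Suc e) K p v S"

lemma K_ge: "K \<ge> 8"
  using K4 X by simp

lemma M_ge: "M \<ge> 5"
  using M X by simp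

lemma T_ge: "T \<ge> 1"
proof -
  have "1 * 1 \<le> (real e + 1) * B"
    using B X by (intro mult_mono) auto
  then have "1 * 1 \<le> M * ((real e + 1) * B)"
    using M_ge by (intro mult_mono) auto
  then show ?thesis by (simp add: T mult.assoc)
qed

lemma power_ge: "j \<ge> 1 \<Longrightarrow> K ^ j \<ge> K"
  using power_increasing[of 1 j K] K_ge by (simp only: power_one_right)

lemma abs_dot_grid_le: "g \<in> G \<Longrightarrow> (\<And>i. i \<le> e \<Longrightarrow> \<bar>a i\<bar> \<le> B) \<Longrightarrow> M * \<bar>dot e a g\<bar> \<le> T * X"
proof -
  assume "g \<in> G" and "\<And>i. i \<le> e \<Longrightarrow> \<bar>a i\<bar> \<le> B"
  then have "\<bar>dot e a g\<bar> \<le> (real e + 1) * B * X"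
    using B X by (intro abs_dot_le) (auto simp: coord_le)
  then have "M * \<bar>dot e a g\<bar> \<le> M * ((real e + 1) * B * X)"
    using M_ge by (intro mult_left_mono) auto
  then show ?thesis by (simp add: T mult.assoc)
qed

text \<open>The functional \<open>M a + u\<close>, with last coefficient \<open>l > 0\<close>,
  counts \<open>g\<close> at height \<open>K ^ j\<close> only if \<open>a\<close> counts
  \<open>g\<close> and \<open>K ^ j < r * K\<close>: if \<open>a\<close> is at least
  \<open>1\<close> at \<open>g\<close>, then \<open>M\<close> outweighs \<open>u\<close>; if
  \<open>K ^ j\<close> is larger, then \<open>l * K ^ j\<close> is at least \<open>K\<close> and
  outweighs all other terms. The role of \<open>u\<close> is to cancel an affine function along the
  line.\<close>

lemma depth_lower:
  assumes a: "\<And>i. i \<le> e \<Longrightarrow> \<bar>a i\<bar> \<le> B" and u: "\<And>i. i \<le> e \<Longrightarrow> \<bar>u i\<bar> \<le> 2 * X"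
    and ug: "\<And>g. g \<in> G \<Longrightarrow> \<bar>dot e u g\<bar> \<le> 3 * X"
    and r: "r > 0" "1 \<le> l * r" "l \<le> K"
    and feas: "\<And>t. t \<in> S \<Longrightarrow> M * (dot e a p + t * dot e a v) + (dot e u p + t * dot e u v)
      + l * (p (Suc e) + t * v (Suc e)) \<le> 0"
  shows "D p v S \<le> real (cnt G e a) * (real (layers m K r) + 1)"
proof -
  define h where "h = (\<lambda>i. M * a i + u i)(Suc e := l)"
  have l: "l > 0" using r by (metis zero_less_mult_pos2 less_le_trans zero_less_one)
  have hdot: "dot (Suc e) h x = M * dot e a x + dot e u x + l * x (Suc e)" for x
    by (simp add: h_def dot_Suc dot_comb)
  have "feasible (Suc e) K p v S h"
    unfolding feasible_def
  proof (intro conjI allI impI ballI)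
    fix i assume i: "i \<le> Suc e"
    show "\<bar>h i\<bar> \<le> K"
    proof (cases "i = Suc e")
      case False
      then have "i \<le> e" using i by simp
      have "\<bar>M * a i + u i\<bar> \<le> M * \<bar>a i\<bar> + \<bar>u i\<bar>"
        using M_ge by (intro order_trans[OF abs_triangle_ineq]) (simp add: abs_mult)
      also have "\<dots> \<le> M * B + 2 * X"
        using a[OF \<open>i \<le> e\<close>] u[OF \<open>i \<le> e\<close>] M_ge by (intro add_mono mult_left_mono) auto
      finally show ?thesis using False K1 by (simp add: h_def)
    qed (use l r in \<open>simp add: h_def\<close>)
  next
    fix t assume "t \<in> S"
    from feas[OF this] show "dot (Suc e) h p + t * dot (Suc e) h v \<le> 0"
      unfolding hdot by (simp add: algebra_simps)
  qed
  then have "D p v S \<le> real (cnt G2 (Suc e) h)" by (rule depth_le_cnt)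
  also have "cnt G2 (Suc e) h \<le> cnt G e a * (layers m K r + 1)"
  proof -
    let ?A = "{g \<in> G. dot e a g < 1} \<times> {j\<in>{1..m}. K ^ j < r * K}"
    have "{x \<in> G2. dot (Suc e) h x < 1} \<subseteq> (\<lambda>(g, j). g(Suc e := K ^ j)) ` ?A"
    proof
      fix x assume "x \<in> {x \<in> G2. dot (Suc e) h x < 1}"
      then obtain g j where g: "g \<in> G" "j \<in> {1..m}" "x = g(Suc e := K ^ j)"
        and lt: "dot (Suc e) h x < 1" by (auto simp: stretch_def)
      have lt': "M * dot e a g + dot e u g + l * K ^ j < 1"
        using lt unfolding hdot g(3) by simp
      have Kj: "l * K ^ j \<ge> 0" using l K_ge by simp
      have "dot e a g < 1"
      proof (rule ccontr)
        assume "\<not> dot e a g < 1"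
        then have "M * 1 \<le> M * dot e a g" using M_ge by (intro mult_left_mono) auto
        then show False using lt' Kj ug[OF g(1)] M by linarith
      qed
      moreover have "K ^ j < r * K"
      proof (rule ccontr)
        assume "\<not> K ^ j < r * K"
        then have "l * (r * K) \<le> l * K ^ j" using l by (intro mult_left_mono) auto
        moreover have "1 * K \<le> (l * r) * K" using r K_ge by (intro mult_right_mono) auto
        ultimately have "K \<le> l * K ^ j" by (simp add: mult.assoc)
        moreover have "\<bar>M * dot e a g\<bar> \<le> T * X"
          using abs_dot_grid_le[of g a, OF g(1) a] M_ge by (simp add: abs_mult)
        ultimately show False using lt' ug[OF g(1)] K2 by linarith
      qed
      ultimately show "x \<in> (\<lambda>(g, j). g(Suc e := K ^ j)) ` ?A" using g by auto
    qed
    then have "cnt G2 (Suc e) h \<le> card ((\<lambda>(g, j). g(Suc e := K ^ j)) ` ?A)"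
      unfolding cnt_def using fin by (intro card_mono) auto
    also have "\<dots> \<le> card ?A" using fin by (intro card_image_le) auto
    also have "\<dots> = cnt G e a * card {j\<in>{1..m}. K ^ j < r * K}"
      by (simp add: card_cartesian_product cnt_def)
    also have "\<dots> \<le> cnt G e a * (layers m K r + 1)"
      using card_layers_below[of K m r] K_ge by (intro mult_left_mono) auto
    finally show ?thesis .
  qed
  finally show ?thesis by (simp add: algebra_simps)
qed

text \<open>With last coefficient \<open>- l\<close> the layers above \<open>r / K\<close> are given
  up completely. On the others \<open>l * K ^ j\<close> is at most \<open>1\<close>, so a point not
  counted by \<open>a\<close> is still not counted after lifting.\<close>

lemma depth_upper:
  assumes a: "\<And>i. i \<le> e \<Longrightarrow> \<bar>a i\<bar> \<le> B" and u: "\<And>i. i \<le> e \<Longrightarrow> \<bar>u i\<bar> \<le> 2 * X"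
    and ug: "\<And>g. g \<in> G \<Longrightarrow> \<bar>dot e u g\<bar> \<le> 3 * X"
    and r: "l \<ge> 0" "l * r \<le> K" "l \<le> K"
    and feas: "\<And>t. t \<in> S \<Longrightarrow> M * (dot e a p + t * dot e a v) + (dot e u p + t * dot e u v)
      - l * (p (Suc e) + t * v (Suc e)) \<le> 0"
  shows "D p v S \<le> real (card G) * (real m - real (layers m K r) + 1)
    + real (cnt G e a) * real (layers m K r)"
proof -
  define h where "h = (\<lambda>i. M * a i + u i)(Suc e := - l)"
  have hdot: "dot (Suc e) h x = M * dot e a x + dot e u x - l * x (Suc e)" for x
    by (simp add: h_def dot_Suc dot_comb)
  have "feasible (Suc e) K p v S h"
    unfolding feasible_def
  proof (intro conjI allI impI ballI)
    fix i assume i: "i \<le> Suc e"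
    show "\<bar>h i\<bar> \<le> K"
    proof (cases "i = Suc e")
      case False
      then have "i \<le> e" using i by simp
      have "\<bar>M * a i + u i\<bar> \<le> M * \<bar>a i\<bar> + \<bar>u i\<bar>"
        using M_ge by (intro order_trans[OF abs_triangle_ineq]) (simp add: abs_mult)
      also have "\<dots> \<le> M * B + 2 * X"
        using a[OF \<open>i \<le> e\<close>] u[OF \<open>i \<le> e\<close>] M_ge by (intro add_mono mult_left_mono) auto
      finally show ?thesis using False K1 by (simp add: h_def)
    qed (use r in \<open>simp add: h_def\<close>)
  next
    fix t assume "t \<in> S"
    from feas[OF this] show "dot (Suc e) h p + t * dot (Suc e) h v \<le> 0"
      unfolding hdot by (simp add: algebra_simps)
  qed
  then have "D p v S \<le> real (cnt G2 (Suc e) h)" by (rule depth_le_cnt)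
  also have "cnt G2 (Suc e) h \<le>
      card G * card {j\<in>{1..m}. K ^ j > r / K} + cnt G e a * layers m K r"
  proof -
    let ?A = "G \<times> {j\<in>{1..m}. K ^ j > r / K}"
      and ?B = "{g \<in> G. dot e a g < 1} \<times> {j\<in>{1..m}. K ^ j \<le> r / K}"
    have "{x \<in> G2. dot (Suc e) h x < 1} \<subseteq> (\<lambda>(g, j). g(Suc e := K ^ j)) ` (?A \<union> ?B)"
    proof
      fix x assume "x \<in> {x \<in> G2. dot (Suc e) h x < 1}"
      then obtain g j where g: "g \<in> G" "j \<in> {1..m}" "x = g(Suc e := K ^ j)"
        and lt: "dot (Suc e) h x < 1" by (auto simp: stretch_def)
      have lt': "M * dot e a g + dot e u g - l * K ^ j < 1"
        using lt unfolding hdot g(3) by simp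
      have "dot e a g < 1" if "K ^ j \<le> r / K"
      proof (rule ccontr)
        assume "\<not> dot e a g < 1"
        then have "M * 1 \<le> M * dot e a g" using M_ge by (intro mult_left_mono) auto
        moreover have "l * K ^ j \<le> l * (r / K)" using that r by (intro mult_left_mono) auto
        moreover have "l * (r / K) \<le> 1" using r K_ge by (simp add: field_simps)
        ultimately show False using lt' ug[OF g(1)] M by linarith
      qed
      then have "(g, j) \<in> ?A \<union> ?B" using g by (cases "K ^ j \<le> r / K") auto
      then show "x \<in> (\<lambda>(g, j). g(Suc e := K ^ j)) ` (?A \<union> ?B)"
        unfolding g(3) by (intro image_eqI[of _ _ "(g, j)"]) auto
    qed
    then have "cnt G2 (Suc e) h \<le> card ((\<lambda>(g, j). g(Suc e := K ^ j)) ` (?A \<union> ?B))"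
      unfolding cnt_def using fin by (intro card_mono) auto
    also have "\<dots> \<le> card (?A \<union> ?B)" using fin by (intro card_image_le) auto
    also have "\<dots> \<le> card ?A + card ?B" by (rule card_Un_le)
    also have "\<dots> = card G * card {j\<in>{1..m}. K ^ j > r / K}
        + cnt G e a * card {j\<in>{1..m}. K ^ j \<le> r / K}"
      by (simp add: card_cartesian_product cnt_def)
    also have "card {j\<in>{1..m}. K ^ j \<le> r / K} \<le> layers m K r"
      unfolding layers_def
    proof (rule card_mono)
      show "{j\<in>{1..m}. K ^ j \<le> r / K} \<subseteq> {j\<in>{1..m}. K ^ j \<le> r}"
      proof clarify
        fix j assume j: "K ^ j \<le> r / K"
        have "0 < K ^ j" using K_ge by simp
        then have "0 < r / K" using j by linarith
        then have "r > 0" using K_ge by (simp add: zero_less_divide_iff)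
        then have "r / K \<le> r" using K_ge by (simp add: field_simps)
        then show "K ^ j \<le> r" using j by linarith
      qed
    qed simp
    finally show ?thesis by simp
  qed
  also have "real (card G * card {j\<in>{1..m}. K ^ j > r / K} + cnt G e a * layers m K r)
      \<le> real (card G) * (real m - real (layers m K r) + 1) + real (cnt G e a) * real (layers m K r)"
  proof -
    have "real (card {j\<in>{1..m}. K ^ j > r / K}) \<le> real m - real (layers m K r) + 1"
      using card_layers_above[of K m r] K_ge by linarith
    then show ?thesis by (simp add: mult_left_mono)
  qed
  finally show ?thesis by simp
qed

text \<open>All layers have height at least \<open>K\<close>, so for \<open>l \<ge> 0\<close> it
  suffices to test the functional at height \<open>K\<close>.\<close>

lemma depth_zero:
  assumes u: "\<And>i. i \<le> e \<Longrightarrow> \<bar>u i\<bar> \<le> K" and l: "0 \<le> l" "l \<le> K"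
    and ug: "\<And>g. g \<in> G \<Longrightarrow> dot e u g + l * K \<ge> 1"
    and feas: "\<And>t. t \<in> S \<Longrightarrow> (dot e u p + t * dot e u v) + l * (p (Suc e) + t * v (Suc e)) \<le> 0"
  shows "D p v S = 0"
proof -
  define h where "h = u(Suc e := l)"
  have hdot: "dot (Suc e) h x = dot e u x + l * x (Suc e)" for x
    by (simp add: h_def dot_Suc)
  have "feasible (Suc e) K p v S h"
    unfolding feasible_def
  proof (intro conjI allI impI ballI)
    show "\<bar>h i\<bar> \<le> K" if "i \<le> Suc e" for i
      using u[of i] l that by (cases "i = Suc e") (simp_all add: h_def)
    show "dot (Suc e) h p + t * dot (Suc e) h v \<le> 0" if "t \<in> S" for t
      using feas[OF that] unfolding hdot by (simp add: algebra_simps)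
  qed
  then have "D p v S \<le> real (cnt G2 (Suc e) h)" by (rule depth_le_cnt)
  also have "{x \<in> G2. dot (Suc e) h x < 1} = {}"
  proof -
    have "dot (Suc e) h (g(Suc e := K ^ j)) \<ge> 1" if "g \<in> G" "j \<ge> 1" for g j
    proof -
      have "l * K \<le> l * K ^ j" using power_ge[OF that(2)] l by (intro mult_left_mono) auto
      then show ?thesis using ug[OF that(1)] by (simp add: hdot)
    qed
    then show ?thesis by (force simp: stretch_def)
  qed
  then have "cnt G2 (Suc e) h = 0" unfolding cnt_def by (simp only: card.empty)
  finally show ?thesis by (simp add: depth_def)
qed

end

section \<open>Arithmetic that eliminates the number of layers below the threshold\<close>

lemma layer_scale:
  fixes m b y z w C c :: real
  assumes "m \<ge> 1" "0 \<le> b" "b \<le> m" "0 \<le> w" "0 \<le> C" "0 \<le> c" "y \<le> (c * m + C) * w"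
  shows "(b + 1) * y \<le> (c * (b + 1) + 2 * C) * (m * w)"
proof -
  have "(b + 1) * y \<le> (b + 1) * ((c * m + C) * w)"
    using assms by (intro mult_left_mono) auto
  also have "\<dots> = (c * (b + 1)) * (m * w) + (b + 1) * (C * w)" by (simp add: algebra_simps)
  \<comment> \<open>Here \<open>b + 1 \<le> 2 * m\<close>, which doubles the error constant.\<close>
  also have "(b + 1) * (C * w) \<le> (2 * m) * (C * w)"
    using assms by (intro mult_right_mono) auto
  finally show ?thesis by (simp add: algebra_simps)
qed

text \<open>\<open>R\<close> and \<open>L\<close> stand for the depths of an upper and a lower ray
  in the stretched grid, \<open>a\<close>, \<open>c\<close>, \<open>d\<close> for depths in the old
  grid. In the first sum one copy of \<open>R\<close> is bounded by the upper layers and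
  \<open>E + 1\<close> copies by \<open>a\<close>. In the second, one copy of \<open>R\<close> and
  one of \<open>L\<close> are bounded through the upper layers; the remainder
  \<open>(E + 1) * c + d + a\<close> is the average of two quantities that are at most
  \<open>Y\<close>.\<close>

lemma rays_near_arith:
  fixes E N m b a c d R L Y C :: real
  assumes "E \<ge> 0" "b \<ge> 0" "N \<ge> 0" "C \<ge> 0"
    and R: "R \<le> N * (m - b + 1)" "R \<le> (b + 1) * a"
    and L: "L \<le> (b + 1) * c" "L \<le> N * (m - b + 1) + (b + 1) * d"
    and Y: "(E + 1) * a + 2 * c \<le> Y" "(E + 1) * c + 2 * a \<le> Y" "(E + 1) * c + 2 * d \<le> Y"
      "(b + 1) * Y \<le> (2 * (b + 1) + 2 * C) * N" "b \<le> m"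
  shows "(E + 2) * R + 2 * L \<le> (2 * m + (8 + 6 * C)) * N"
    and "(E + 2) * L + 2 * R \<le> (2 * m + (8 + 6 * C)) * N"
proof -
  have CN: "C * N \<ge> 0" "N * (m - b) \<ge> 0" using assms by simp_all
  have "(E + 1) * R \<le> (E + 1) * ((b + 1) * a)" using assms by (intro mult_left_mono) auto
  then have "(E + 2) * R + 2 * L \<le> N * (m - b + 1) + (b + 1) * ((E + 1) * a + 2 * c)"
    using R L by (simp add: algebra_simps)
  also have "(b + 1) * ((E + 1) * a + 2 * c) \<le> (b + 1) * Y"
    using assms by (intro mult_left_mono) auto
  finally show "(E + 2) * R + 2 * L \<le> (2 * m + (8 + 6 * C)) * N"
    using Y CN \<open>N \<ge> 0\<close> by (simp add: algebra_simps)
  have "(E + 1) * L \<le> (E + 1) * ((b + 1) * c)" using assms by (intro mult_left_mono) auto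
  then have "(E + 2) * L + 2 * R \<le> 2 * (N * (m - b + 1)) + (b + 1) * ((E + 1) * c + d + a)"
    using R L by (simp add: algebra_simps)
  also have "(b + 1) * ((E + 1) * c + d + a) \<le> (b + 1) * Y"
    using assms by (intro mult_left_mono) auto
  finally show "(E + 2) * L + 2 * R \<le> (2 * m + (8 + 6 * C)) * N"
    using Y CN \<open>N \<ge> 0\<close> by (simp add: algebra_simps)
qed

text \<open>For rays from an endpoint just above the root of the new coordinate: \<open>c\<close> is
  the depth of the projected endpoint, and the upper ray is bounded through the whole line.\<close>

lemma rays_close_arith:
  fixes E N m b c R L C :: real
  assumes "E \<ge> 1" "b \<ge> 0" "N \<ge> 0" "C \<ge> 0"
    and R: "R \<le> N * (m - b + 1)" "(E + 3) * R \<le> (2 * m + (4 + 4 * C)) * N"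
    and L: "L \<le> (b + 1) * c" and "c \<ge> 0"
    and c: "(b + 1) * ((E + 1) * c) \<le> ((b + 1) + 2 * C) * N"
  shows "(E + 2) * R + 2 * L \<le> (2 * m + (8 + 6 * C)) * N"
    and "(E + 2) * L + 2 * R \<le> (2 * m + (8 + 6 * C)) * N"
proof -
  have CN: "C * N \<ge> 0" "E * N \<ge> 0" "E * (C * N) \<ge> 0" using assms by simp_all
  have L1: "(E + 1) * L \<le> ((b + 1) + 2 * C) * N"
    using mult_left_mono[OF L, of "E + 1"] c \<open>E \<ge> 1\<close> by (simp add: algebra_simps)
  have R1: "E * ((E + 3) * R) \<le> E * ((2 * m + (4 + 4 * C)) * N)"
    using R assms by (intro mult_left_mono) auto
  \<comment> \<open>The weights are chosen so that the whole-line bound enters \<open>E\<close>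
    times and the upper-layer bound twice; then \<open>b\<close> cancels against the bound for
    \<open>L\<close>.\<close>
  have "(E + 1) * ((E + 2) * R + 2 * L) = E * ((E + 3) * R) + 2 * R + 2 * ((E + 1) * L)"
    by (simp add: algebra_simps)
  also have "\<dots> \<le> E * ((2 * m + (4 + 4 * C)) * N) + 2 * (N * (m - b + 1))
      + 2 * (((b + 1) + 2 * C) * N)"
    using R1 R(1) L1 by linarith
  also have "\<dots> \<le> (E + 1) * ((2 * m + (8 + 6 * C)) * N)"
    using CN \<open>N \<ge> 0\<close> by (simp add: algebra_simps)
  finally show "(E + 2) * R + 2 * L \<le> (2 * m + (8 + 6 * C)) * N"
    using \<open>E \<ge> 1\<close> by simp
  have "(E + 2) * L \<le> (E + 2) * ((b + 1) * c)"
    using L assms by (intro mult_left_mono) auto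
  also have "\<dots> \<le> (2 * (E + 1)) * ((b + 1) * c)"
    using assms by (intro mult_right_mono) auto
  also have "\<dots> = 2 * ((b + 1) * ((E + 1) * c))" by simp
  finally have "(E + 2) * L \<le> 2 * (((b + 1) + 2 * C) * N)" using c by linarith
  then show "(E + 2) * L + 2 * R \<le> (2 * m + (8 + 6 * C)) * N"
    using R(1) CN \<open>N \<ge> 0\<close> by (simp add: algebra_simps)
qed

section \<open>Lines in the stretched grid: points, rays, and lines that project to a point\<close>

text \<open>The projection has the same \<open>p\<close> and \<open>v\<close>, since
  \<open>dot e\<close> reads only the coordinates up to \<open>e\<close>; \<open>bounds\<close> is
  the induction hypothesis for it. The assumption on \<open>v (Suc e)\<close> orients the line
  upwards. Depths in the old grid use the bound \<open>B'\<close>, while \<open>B\<close> leaves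
  room for auxiliary functionals.\<close>

locale stretching_line = stretching +
  fixes C B' :: real and p v :: "nat \<Rightarrow> real"
  assumes m: "m \<ge> 1" and card_G: "card G = m ^ e" and C: "C \<ge> 0" and B': "0 \<le> B'" "B' \<le> B"
    and p0: "p 0 = 1" and v0: "v 0 = 0" and v_last: "v (Suc e) \<ge> 0"
    and bounds: "line_bounds e (real e + 1) C m G B' p v"
begin

abbreviation "xn \<equiv> \<lambda>t. p (Suc e) + t * v (Suc e)"
abbreviation "D' \<equiv> \<lambda>S. depth G e B' p v S"
abbreviation "N \<equiv> real m ^ e"
abbreviation "b \<equiv> \<lambda>r. real (layers m K r)"

lemma b_le: "b r \<le> real m"
  using layers_le[of m K r] by simp

lemma N_eq: "N = real m * real m ^ (e - 1)"
  using e by (cases e) auto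

lemma card_G_real: "real (card G) = N"
  by (simp add: card_G)

lemma D'_nonneg: "D' S \<ge> 0"
  by (simp add: depth_def)

lemma D_nonneg: "D p v S \<ge> 0"
  by (simp add: depth_def)

lemma D'_mono: "S \<subseteq> S' \<Longrightarrow> D' S \<le> D' S'"
  using B'(1) by (rule depth_mono)

lemma D_mono: "S \<subseteq> S' \<Longrightarrow> D p v S \<le> D p v S'"
  using K_ge by (intro depth_mono) auto

lemma D'_attained:
  obtains a where "\<And>i. i \<le> e \<Longrightarrow> \<bar>a i\<bar> \<le> B" "\<And>t. t \<in> S \<Longrightarrow> dot e a p + t * dot e a v \<le> 0"
    "real (cnt G e a) = D' S"
proof -
  obtain a where a: "feasible e B' p v S a" "real (cnt G e a) = D' S"
    by (rule depth_attained[OF B'(1)])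
  show thesis
  proof (rule that[OF _ _ a(2)])
    show "\<bar>a i\<bar> \<le> B" if "i \<le> e" for i
      using a(1) that B'(2) unfolding feasible_def by (meson order_trans)
    show "dot e a p + t * dot e a v \<le> 0" if "t \<in> S" for t
      using a(1) that unfolding feasible_def by blast
  qed
qed

lemma scaled_point: "(b r + 1) * ((real e + 1) * D' {t}) \<le> ((b r + 1) + 2 * C) * N"
proof -
  have "(real e + 1) * D' {t} \<le> (1 * real m + C) * real m ^ (e - 1)"
    using bounds by (simp add: line_bounds_def)
  then have "(b r + 1) * ((real e + 1) * D' {t}) \<le> (1 * (b r + 1) + 2 * C) * (real m * real m ^ (e - 1))"
    by (rule layer_scale[rotated -1]) (use m C b_le in auto)
  then show ?thesis by (simp add: N_eq)
qed

definition Y where "Y = (2 * real m + C) * real m ^ (e - 1)"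

lemma scaled_Y: "(b r + 1) * Y \<le> (2 * (b r + 1) + 2 * C) * N"
  unfolding N_eq Y_def by (rule layer_scale) (use m C b_le in auto)

lemma bounds_Y:
  "(real e + 1) * D' UNIV \<le> Y"
  "(real e + 1) * D' {q..} + 2 * D' {..q} \<le> Y"
  "(real e + 1) * D' {..q} + 2 * D' {q..} \<le> Y"
  using bounds by (simp_all add: line_bounds_def Y_def)

lemma dot_coord_fun_p [simp]: "i \<le> e \<Longrightarrow> i \<noteq> 0 \<Longrightarrow> dot e (coord_fun i c0 c1) p = c0 + c1 * p i"
  by (simp add: dot_coord_fun p0)

lemma dot_coord_fun_v [simp]: "i \<le> e \<Longrightarrow> i \<noteq> 0 \<Longrightarrow> dot e (coord_fun i c0 c1) v = c1 * v i"
  by (simp add: dot_coord_fun v0)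

lemma dot_coord_fun_G [simp]:
  "i \<le> e \<Longrightarrow> i \<noteq> 0 \<Longrightarrow> g \<in> G \<Longrightarrow> dot e (coord_fun i c0 c1) g = c0 + c1 * g i"
  by (simp add: dot_coord_fun coord0)

lemma cnt_coord_fun_1: "cnt G e (coord_fun 1 1 0) = 0"
proof -
  have "{g \<in> G. dot e (coord_fun 1 1 0) g < 1} = {}" using e by auto
  then show ?thesis unfolding cnt_def by (simp only: card.empty)
qed

text \<open>The functional that subtracts \<open>1\<close> from the new coordinate is nonpositive on
  \<open>S\<close> and at least \<open>K - 1\<close> on the grid.\<close>

lemma depth_low_zero:
  assumes "\<And>t. t \<in> S \<Longrightarrow> xn t \<le> 1"
  shows "D p v S = 0"
  by (rule depth_zero[where u = "coord_fun 1 (- 1) 0" and l = 1])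
    (use e K_ge assms in \<open>auto intro!: abs_coord_fun_le\<close>)

text \<open>The halfspace of points of height at least \<open>y\<close> is lifted from the constant
  functional \<open>1\<close>, which counts no point of \<open>G\<close>; so only the upper layers
  remain. The threshold \<open>r\<close> may exceed \<open>y\<close> by a factor
  \<open>K / M\<close>.\<close>

lemma depth_top:
  assumes y: "y > 0" "M \<le> K * y" "M * r \<le> K * y" and S: "\<And>t. t \<in> S \<Longrightarrow> xn t \<ge> y"
  shows "D p v S \<le> N * (real m - b r + 1)"
proof -
  have "D p v S \<le> real (card G) * (real m - b r + 1) + real (cnt G e (coord_fun 1 1 0)) * b r"
  proof (rule depth_upper[where u = "\<lambda>_. 0" and l = "M / y"])
    fix t assume "t \<in> S"
    then have "M * 1 \<le> M * (xn t / y)" using S y M_ge by (intro mult_left_mono) auto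
    then show "M * (dot e (coord_fun 1 1 0) p + t * dot e (coord_fun 1 1 0) v)
      + (dot e (\<lambda>_. 0) p + t * dot e (\<lambda>_. 0) v) - M / y * xn t \<le> 0"
      using e by (simp add: dot_def[of e "\<lambda>_. 0"])
  qed (use y M_ge B X in \<open>auto simp: dot_def[of e "\<lambda>_. 0"] field_simps intro!: abs_coord_fun_le\<close>)
  then show ?thesis unfolding cnt_coord_fun_1 card_G_real by simp
qed

text \<open>A functional \<open>a\<close> that is best at \<open>q\<close> is lifted with constant
  \<open>- 1\<close> and last coefficient \<open>1 / y\<close>. Away from \<open>q\<close> the
  change of \<open>M a\<close> is at most \<open>s * \<bar>t - q\<bar>\<close>, which the drop of
  the height below \<open>y\<close> compensates.\<close>

lemma depth_point:
  assumes y: "y = xn q" "y \<ge> 1"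
    and s: "\<And>a. (\<And>i. i \<le> e \<Longrightarrow> \<bar>a i\<bar> \<le> B) \<Longrightarrow> M * \<bar>dot e a v\<bar> \<le> s"
    and S: "\<And>t. t \<in> S \<Longrightarrow> s * \<bar>t - q\<bar> * y \<le> y - xn t"
  shows "D p v S \<le> (b y + 1) * D' {q}"
proof -
  obtain a where a: "\<And>i. i \<le> e \<Longrightarrow> \<bar>a i\<bar> \<le> B" "\<And>t. t \<in> {q} \<Longrightarrow> dot e a p + t * dot e a v \<le> 0"
    "real (cnt G e a) = D' {q}"
    using D'_attained[of "{q}"] by blast
  have "D p v S \<le> real (cnt G e a) * (b y + 1)"
  proof (rule depth_lower[where u = "coord_fun 1 (- 1) 0" and l = "1 / y"])
    fix t assume t: "t \<in> S"
    have "M * dot e a v * (t - q) \<le> \<bar>M * dot e a v\<bar> * \<bar>t - q\<bar>"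
      by (metis abs_ge_self abs_mult)
    also have "\<dots> \<le> s * \<bar>t - q\<bar>"
      using s[of a, OF a(1)] M_ge by (intro mult_right_mono) (auto simp: abs_mult)
    also have "\<dots> \<le> 1 - xn t / y"
      using S[OF t] y by (simp add: field_simps)
    finally have "M * dot e a v * (t - q) \<le> 1 - xn t / y" .
    moreover have "M * (dot e a p + q * dot e a v) \<le> 0"
      using a(2)[of q] M_ge by (simp add: mult_le_0_iff)
    ultimately show "M * (dot e a p + t * dot e a v)
      + (dot e (coord_fun 1 (- 1) 0) p + t * dot e (coord_fun 1 (- 1) 0) v) + 1 / y * xn t \<le> 0"
      using e by (simp add: algebra_simps add_divide_distrib)
  next
    show "\<bar>a i\<bar> \<le> B" if "i \<le> e" for i using a(1) that .
    have "1 / y \<le> 1" using y(2) by simp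
    then show "1 / y \<le> K" using K_ge by linarith
  qed (use y e X in \<open>auto intro!: abs_coord_fun_le\<close>)
  then show ?thesis by (simp add: a(3) mult.commute)
qed

lemma abs_slope_le:
  assumes "\<And>i. i \<le> e \<Longrightarrow> \<bar>v i\<bar> \<le> 1" "\<And>i. i \<le> e \<Longrightarrow> \<bar>a i\<bar> \<le> B"
  shows "M * \<bar>dot e a v\<bar> \<le> T"
proof -
  have "\<bar>dot e a v\<bar> \<le> (real e + 1) * B * 1"
    by (rule abs_dot_le) (use assms B X in auto)
  then have "M * \<bar>dot e a v\<bar> \<le> M * ((real e + 1) * B * 1)"
    using M_ge by (intro mult_left_mono) auto
  then show ?thesis by (simp add: T mult.assoc)
qed

lemma depth_top': "1 \<le> y \<Longrightarrow> (\<And>t. t \<in> S \<Longrightarrow> xn t \<ge> y) \<Longrightarrow> D p v S \<le> N * (real m - b y + 1)"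
proof -
  assume y: "1 \<le> y" and S: "\<And>t. t \<in> S \<Longrightarrow> xn t \<ge> y"
  have "0 \<le> M * T" using M_ge T_ge by simp
  then have "M \<le> K" using K3 M_ge T_ge by linarith
  then have "M * y \<le> K * y" using y by (intro mult_right_mono) auto
  moreover have "M * 1 \<le> M * y" using y M_ge by (intro mult_left_mono) auto
  ultimately have "M \<le> K * y" "M * y \<le> K * y" by simp_all
  then show "D p v S \<le> N * (real m - b y + 1)"
    using y S by (intro depth_top[of y]) auto
qed

text \<open>A point can be cut off through its projection, at a cost in the layers below its height
  only, or by giving up the layers above. Taking the first bound \<open>e + 1\<close> times and the
  second once eliminates \<open>b y\<close>.\<close>

lemma point_bound: "(real e + 2) * D p v {t} \<le> (real m + (8 + 6 * C)) * N"
proof (cases "xn t \<le> 1")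
  case True
  then have "D p v {t} = 0" by (intro depth_low_zero) auto
  then show ?thesis using C by simp
next
  case False
  define y where "y = xn t"
  \<comment> \<open>Any bound on the slopes will do here, because \<open>t - q\<close> vanishes on a
    one-point set.\<close>
  obtain s where s: "\<And>a. (\<And>i. i \<le> e \<Longrightarrow> \<bar>a i\<bar> \<le> B) \<Longrightarrow> M * \<bar>dot e a v\<bar> \<le> s"
  proof -
    have "M * \<bar>dot e a v\<bar> \<le> M * ((real e + 1) * B * (\<Sum>i\<le>e. \<bar>v i\<bar>))"
      if "\<And>i. i \<le> e \<Longrightarrow> \<bar>a i\<bar> \<le> B" for a
      using M_ge B X that
      by (intro mult_left_mono abs_dot_le) (auto intro: member_le_sum[of _ "{..e}" "\<lambda>i. \<bar>v i\<bar>"])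
    then show thesis using that by blast
  qed
  have 1: "D p v {t} \<le> (b y + 1) * D' {t}"
    using False by (intro depth_point[OF y_def _ s]) (auto simp: y_def)
  have 2: "D p v {t} \<le> N * (real m - b y + 1)"
    using False by (intro depth_top') (auto simp: y_def)
  have "(real e + 1) * D p v {t} \<le> (real e + 1) * ((b y + 1) * D' {t})"
    using 1 by (intro mult_left_mono) auto
  then have "(real e + 2) * D p v {t} \<le> ((b y + 1) + 2 * C) * N + N * (real m - b y + 1)"
    using 2 scaled_point[of y t] by (simp add: algebra_simps)
  also have "\<dots> \<le> (real m + (8 + 6 * C)) * N" using C by (simp add: algebra_simps)
  finally show ?thesis .
qed

text \<open>If \<open>q\<close> has height at most \<open>1\<close>, its lower ray has depth
  \<open>0\<close> and its upper ray is bounded by the whole line. This leaves endpoints above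
  height \<open>1\<close>.\<close>

lemma line_bounds_stretchI:
  assumes whole: "(real e + 3) * D p v UNIV \<le> (2 * real m + (4 + 4 * C)) * N"
    and rays: "\<And>q. xn q > 1 \<Longrightarrow>
      (real e + 2) * D p v {q..} + 2 * D p v {..q} \<le> (2 * real m + (8 + 6 * C)) * N \<and>
      (real e + 2) * D p v {..q} + 2 * D p v {q..} \<le> (2 * real m + (8 + 6 * C)) * N"
  shows "line_bounds (Suc e) (real e + 3) (8 + 6 * C) m G2 K p v"
proof -
  have slack: "(2 * real m + (4 + 4 * C)) * N \<le> (2 * real m + (8 + 6 * C)) * N"
    using C by (intro mult_right_mono) auto
  have "(real e + 2) * D p v {q..} + 2 * D p v {..q} \<le> (2 * real m + (8 + 6 * C)) * N \<and>
      (real e + 2) * D p v {..q} + 2 * D p v {q..} \<le> (2 * real m + (8 + 6 * C)) * N" for q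
  proof (cases "xn q > 1")
    case False
    have "xn t \<le> 1" if "t \<in> {..q}" for t
      using False mult_right_mono[of t q "v (Suc e)"] that v_last by simp
    then have L: "D p v {..q} = 0" by (intro depth_low_zero) auto
    have "(real e + 2) * D p v {q..} \<le> (real e + 3) * D p v UNIV"
      using D_mono[of "{q..}" UNIV] D_nonneg by (intro mult_mono) auto
    moreover have "2 * D p v {q..} \<le> (real e + 3) * D p v UNIV"
      using D_mono[of "{q..}" UNIV] D_nonneg by (intro mult_mono) auto
    ultimately show ?thesis using L whole slack by auto
  qed (rule rays)
  moreover have "(real e + 3) * D p v UNIV \<le> (2 * real m + (8 + 6 * C)) * N"
    using whole slack by linarith
  ultimately show ?thesis
    unfolding line_bounds_def using point_bound by (simp add: add.commute)
qed

lemma line_bounds_zero: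
  assumes "D p v UNIV = 0"
  shows "line_bounds (Suc e) (real e + 3) (8 + 6 * C) m G2 K p v"
proof (rule line_bounds_stretchI)
  have "D p v S = 0" for S using D_mono[of S UNIV] D_nonneg[of S] assms by simp
  then show "(real e + 2) * D p v {q..} + 2 * D p v {..q} \<le> (2 * real m + (8 + 6 * C)) * N \<and>
      (real e + 2) * D p v {..q} + 2 * D p v {q..} \<le> (2 * real m + (8 + 6 * C)) * N" for q
    using C by simp
qed (use assms C in simp)

lemma rays_close:
  assumes whole: "(real e + 3) * D p v UNIV \<le> (2 * real m + (4 + 4 * C)) * N"
    and q: "xn q \<ge> 1" and low: "D p v {..q} \<le> (b (xn q) + 1) * D' {q}"
  shows "(real e + 2) * D p v {q..} + 2 * D p v {..q} \<le> (2 * real m + (8 + 6 * C)) * N \<and>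
      (real e + 2) * D p v {..q} + 2 * D p v {q..} \<le> (2 * real m + (8 + 6 * C)) * N"
proof -
  have "D p v {q..} \<le> N * (real m - b (xn q) + 1)"
    using q v_last by (intro depth_top') (auto intro: mult_right_mono)
  moreover have "(real e + 3) * D p v {q..} \<le> (2 * real m + (4 + 4 * C)) * N"
    by (rule order_trans[OF mult_left_mono[OF D_mono] whole]) auto
  ultimately show ?thesis
    using rays_close_arith[of "real e" "b (xn q)" N C "D p v {q..}" "real m" "D p v {..q}" "D' {q}"]
      e C low D'_nonneg scaled_point by simp
qed

text \<open>A functional best at the projected point is constant along the line when the new
  coordinate is ignored, so the whole line has depth at most \<open>m\<close> times that of the
  point. As \<open>e \<ge> 1\<close>, one has \<open>e + 3 \<le> 2 * (e + 1)\<close>, and the bound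
  for points suffices. Since slopes vanish, the rays fall under \<open>rays_close\<close>.\<close>

lemma line_bounds_vertical:
  assumes v: "\<And>i. i \<le> e \<Longrightarrow> v i = 0"
  shows "line_bounds (Suc e) (real e + 3) (8 + 6 * C) m G2 K p v"
proof (rule line_bounds_stretchI)
  have av: "dot e a v = 0" for a using v by (simp add: dot_def)
  show whole: "(real e + 3) * D p v UNIV \<le> (2 * real m + (4 + 4 * C)) * N"
  proof -
    have "D p v UNIV \<le> (real m + 1) * D' {0}"
    proof -
      obtain a where a: "\<And>i. i \<le> e \<Longrightarrow> \<bar>a i\<bar> \<le> B" "\<And>t. t \<in> {0} \<Longrightarrow> dot e a p + t * dot e a v \<le> 0"
        "real (cnt G e a) = D' {0}"
        using D'_attained[of "{0}"] by blast
      define h where "h = a(Suc e := 0)"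
      have hd: "dot (Suc e) h x = dot e a x" for x by (simp add: h_def dot_Suc)
      have "B \<le> K"
      proof -
        have "1 * B \<le> M * B" using M_ge B X by (intro mult_right_mono) auto
        then show ?thesis using K1 X by linarith
      qed
      then have "feasible (Suc e) K p v UNIV h"
        unfolding feasible_def hd using a av K_ge by (force simp: h_def le_Suc_eq)
      then have "D p v UNIV \<le> real (cnt G2 (Suc e) h)" by (rule depth_le_cnt)
      also have "cnt G2 (Suc e) h \<le> cnt G e a * m"
      proof -
        have "{x \<in> G2. dot (Suc e) h x < 1} \<subseteq>
            (\<lambda>(g, j). g(Suc e := K ^ j)) ` ({g \<in> G. dot e a g < 1} \<times> {1..m})"
          unfolding hd by (auto simp: stretch_def)
        then have "cnt G2 (Suc e) h \<le>
            card ((\<lambda>(g, j). g(Suc e := K ^ j)) ` ({g \<in> G. dot e a g < 1} \<times> {1..m}))"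
          unfolding cnt_def using fin by (intro card_mono) auto
        also have "\<dots> \<le> card ({g \<in> G. dot e a g < 1} \<times> {1..m})"
          using fin by (intro card_image_le) auto
        finally show ?thesis by (simp add: card_cartesian_product cnt_def)
      qed
      finally have "D p v UNIV \<le> D' {0} * real m" using a(3) by simp
      then show ?thesis using D'_nonneg[of "{0}"] by (simp add: algebra_simps)
    qed
    then have "(real e + 3) * D p v UNIV \<le> (real e + 3) * ((real m + 1) * D' {0})"
      by (intro mult_left_mono) auto
    also have "\<dots> \<le> (2 * (real e + 1)) * ((real m + 1) * D' {0})"
      using e D'_nonneg by (intro mult_right_mono) auto
    also have "\<dots> = 2 * ((real m + 1) * ((real e + 1) * D' {0}))" by simp
    also have "(real m + 1) * ((real e + 1) * D' {0}) \<le> (1 * (real m + 1) + 2 * C) * (real m * real m ^ (e - 1))"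
      by (rule layer_scale) (use m C bounds in \<open>auto simp: line_bounds_def\<close>)
    finally have "(real e + 3) * D p v UNIV \<le> 2 * ((real m + 1 + 2 * C) * N)"
      unfolding N_eq by simp
    also have "\<dots> \<le> (2 * real m + (4 + 4 * C)) * N" by (simp add: algebra_simps)
    finally show ?thesis .
  qed
  fix q assume q: "xn q > 1"
  have "D p v {..q} \<le> (b (xn q) + 1) * D' {q}"
    by (rule depth_point[where s = 0])
      (use q v_last in \<open>auto simp: av intro: mult_right_mono\<close>)
  with whole q show "(real e + 2) * D p v {q..} + 2 * D p v {..q} \<le> (2 * real m + (8 + 6 * C)) * N \<and>
      (real e + 2) * D p v {..q} + 2 * D p v {q..} \<le> (2 * real m + (8 + 6 * C)) * N"
    by (intro rays_close) auto
qed

end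

text \<open>This is the estimate of the minimum of \<open>\<alpha> A\<close> and
  \<open>1 - \<alpha> + \<alpha> A'\<close>: the first bound is used \<open>E + 1\<close> times and
  the second twice, so that the inequality for complementary rays applies and \<alpha>
  cancels.\<close>

lemma whole_arith:
  fixes E N m b a d R Y C :: real
  assumes "E \<ge> 0" "b \<ge> 0" "N \<ge> 0" "C \<ge> 0"
    and R: "R \<le> (b + 1) * a" "R \<le> N * (m - b + 1) + (b + 1) * d"
    and Y: "(E + 1) * a + 2 * d \<le> Y" "(b + 1) * Y \<le> (2 * (b + 1) + 2 * C) * N"
  shows "(E + 3) * R \<le> (2 * m + (4 + 4 * C)) * N"
proof -
  have CN: "C * N \<ge> 0" using assms by simp
  have "(E + 1) * R \<le> (E + 1) * ((b + 1) * a)" using assms by (intro mult_left_mono) auto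
  then have "(E + 3) * R \<le> 2 * (N * (m - b + 1)) + (b + 1) * ((E + 1) * a + 2 * d)"
    using R(2) by (simp add: algebra_simps)
  also have "(b + 1) * ((E + 1) * a + 2 * d) \<le> (b + 1) * Y"
    using assms by (intro mult_left_mono) auto
  finally show ?thesis using Y(2) CN by (simp add: algebra_simps)
qed

section \<open>Lines with normalized, nondegenerate projection\<close>

locale normal_line = stretching_line +
  fixes k :: nat
  assumes k: "k \<le> e" "\<bar>v k\<bar> = 1" "p k = 0" and v_le: "\<And>i. i \<le> e \<Longrightarrow> \<bar>v i\<bar> \<le> 1"
begin

lemma k_nz: "k \<noteq> 0"
  using k v0 by (metis abs_zero zero_neq_one)

lemma vk_sq: "v k * v k = 1"
  using k(2) by (metis abs_mult_self_eq mult_1)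

text \<open>On the line the parameter \<open>t\<close> equals \<open>v k\<close> times the
  coordinate \<open>k\<close>, as \<open>p k = 0\<close> and \<open>v k\<close> is a sign. So this
  functional extends \<open>c0 + c1 * t\<close> from the line to the whole space with bounded
  coefficients.\<close>

definition "\<tau> c0 c1 = coord_fun k c0 (c1 * v k)"

lemma dot_\<tau>_p [simp]: "dot e (\<tau> c0 c1) p = c0"
  using k k_nz by (simp add: \<tau>_def)

lemma dot_\<tau>_v [simp]: "dot e (\<tau> c0 c1) v = c1"
  using k k_nz vk_sq by (simp add: \<tau>_def mult.assoc)

lemma dot_\<tau>_G:
  assumes "g \<in> G"
  shows "\<bar>dot e (\<tau> c0 c1) g - c0\<bar> \<le> \<bar>c1\<bar> * X"
proof -
  have "\<bar>c1 * v k * g k\<bar> \<le> \<bar>c1\<bar> * X"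
    using coord_le[OF assms k(1)] k(2) by (simp add: abs_mult mult_left_mono)
  then show ?thesis using k(1) k_nz assms by (simp add: \<tau>_def)
qed

lemma abs_\<tau>_le: "\<bar>c0\<bar> \<le> c \<Longrightarrow> \<bar>c1\<bar> \<le> c \<Longrightarrow> \<bar>\<tau> c0 c1 i\<bar> \<le> c"
  unfolding \<tau>_def using k(2) by (intro abs_coord_fun_le) (auto simp: abs_mult)

abbreviation "P \<equiv> p (Suc e)"
abbreviation "V \<equiv> v (Suc e)"

lemma M_le_K: "2 * M \<le> K" and T_le_K: "1 + T \<le> K" and MT_le_K: "M * T \<le> K"
proof -
  have "0 \<le> M * T" using M_ge T_ge by simp
  then show "2 * M \<le> K" "1 + T \<le> K" "M * T \<le> K" using K3 M_ge T_ge by linarith+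
qed

text \<open>Subtracting from the new coordinate its affine expression in \<open>t\<close> gives a
  functional that vanishes on the line; on the grid the height \<open>K\<close> dominates.\<close>

lemma small:
  assumes "\<bar>P\<bar> \<le> 4 * X" "V \<le> 2"
  shows "D p v UNIV = 0"
proof (rule depth_zero[where u = "\<tau> (- P) (- V)" and l = 1])
  show "\<bar>\<tau> (- P) (- V) i\<bar> \<le> K" for i
    using assms v_last K4 K_ge X by (intro abs_\<tau>_le) auto
  fix g assume "g \<in> G"
  then have "\<bar>dot e (\<tau> (- P) (- V)) g + P\<bar> \<le> V * X" using dot_\<tau>_G[of g "- P" "- V"] v_last by simp
  moreover have "V * X \<le> 2 * X" using assms X by (intro mult_right_mono) auto
  ultimately show "1 \<le> dot e (\<tau> (- P) (- V)) g + 1 * K" using assms K4 X by linarith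
qed (use K_ge in auto)

text \<open>The same functional is rescaled by \<open>l\<close> so that its constant term is
  \<open>4\<close>. On \<open>G\<close> the term in \<open>t\<close> changes this by at most
  \<open>2\<close>, since the root of the new coordinate is far from the grid.\<close>

lemma far_neg:
  assumes "2 * X * V \<le> \<bar>P\<bar>" "P \<le> - (4 * X)"
  shows "D p v UNIV = 0"
proof -
  have P: "P \<le> - 4" using assms X by linarith
  define l where "l = - 4 / P"
  have l: "l > 0" "l \<le> 1" "l * P = - 4" using P by (auto simp: l_def field_simps)
  have "l * (2 * X * V) \<le> l * \<bar>P\<bar>" using assms l by (intro mult_left_mono) auto
  also have "\<dots> = 4" using l P by simp
  finally have lVX: "l * V * X \<le> 2" by (simp add: algebra_simps)
  have "l * V * 1 \<le> l * V * X" using l v_last X by (intro mult_left_mono) auto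
  then have lV: "l * V \<le> 2" using lVX by simp
  show ?thesis
  proof (rule depth_zero[where u = "\<tau> 4 (- (l * V))" and l = l])
    show "\<bar>\<tau> 4 (- (l * V)) i\<bar> \<le> K" for i
      using l v_last lV K_ge by (intro abs_\<tau>_le) auto
    fix g assume "g \<in> G"
    then have "\<bar>dot e (\<tau> 4 (- (l * V))) g - 4\<bar> \<le> l * V * X"
      using dot_\<tau>_G[of g 4 "- (l * V)"] v_last l by (simp add: abs_mult)
    moreover have "l * K \<ge> 0" using l K_ge by simp
    ultimately show "1 \<le> dot e (\<tau> 4 (- (l * V))) g + l * K" using lVX by linarith
  next
    show "dot e (\<tau> 4 (- (l * V))) p + t * dot e (\<tau> 4 (- (l * V))) v + l * xn t \<le> 0" for t
      using l by (simp add: algebra_simps)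
  qed (use l K_ge in auto)
qed

text \<open>Over the range of the grid the new coordinate stays comparable to \<open>P\<close>,
  which serves as threshold. The whole line then costs either only its upper layers or only its
  lower layers.\<close>

lemma far_pos:
  assumes P: "2 * X * V \<le> P" "4 * X \<le> P"
  shows "line_bounds (Suc e) (real e + 3) (8 + 6 * C) m G2 K p v"
proof -
  have P4: "P \<ge> 4" using P X by linarith
  have VX: "V * X / P \<le> 1 / 2" using P P4 by (simp add: field_simps)
  have "V * 1 \<le> V * X" using X v_last by (intro mult_left_mono) auto
  then have V1: "V / P \<le> 1 / 2" using VX P4 by (simp add: field_simps)
  have low: "D p v S \<le> (b P + 1) * D' S" for S
  proof -
    obtain a where a: "\<And>i. i \<le> e \<Longrightarrow> \<bar>a i\<bar> \<le> B" "\<And>t. t \<in> S \<Longrightarrow> dot e a p + t * dot e a v \<le> 0"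
      "real (cnt G e a) = D' S" using D'_attained[of S] by blast
    have "D p v S \<le> real (cnt G e a) * (b P + 1)"
    proof (rule depth_lower[where u = "\<tau> (- 1) (- (V / P))" and l = "1 / P"])
      show "\<bar>a i\<bar> \<le> B" if "i \<le> e" for i using a(1) that .
      have "\<bar>- (V / P)\<bar> = V / P" using v_last P4 by simp
      then show "\<bar>\<tau> (- 1) (- (V / P)) i\<bar> \<le> 2 * X" for i
        using V1 X by (intro abs_\<tau>_le) linarith+
      have "1 / P \<le> 1" using P4 by simp
      then show "1 / P \<le> K" using K_ge by linarith
      show "\<bar>dot e (\<tau> (- 1) (- (V / P))) g\<bar> \<le> 3 * X" if "g \<in> G" for g
      proof -
        have "\<bar>dot e (\<tau> (- 1) (- (V / P))) g - - 1\<bar> \<le> V * X / P"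
          using dot_\<tau>_G[OF that, of "- 1" "- (V / P)"] v_last P4 by simp
        then show ?thesis using VX X by linarith
      qed
      fix t assume "t \<in> S"
      then have "M * (dot e a p + t * dot e a v) \<le> 0"
        using a(2) M_ge by (simp add: mult_le_0_iff)
      then show "M * (dot e a p + t * dot e a v) +
          (dot e (\<tau> (- 1) (- (V / P))) p + t * dot e (\<tau> (- 1) (- (V / P))) v) + 1 / P * xn t \<le> 0"
        using P4 by (simp add: add_divide_distrib)
    qed (use P4 in auto)
    then show ?thesis by (simp add: a(3) mult.commute)
  qed
  have up: "D p v UNIV \<le> N * (real m - b P + 1)"
  proof -
    \<comment> \<open>This is \<open>2 / P\<close> times the affine expression of the height in
      \<open>t\<close>. It is at least \<open>1\<close> on \<open>G\<close>, and the lifted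
      functional vanishes on the line.\<close>
    let ?a = "\<tau> 2 (2 * V / P)"
    have "D p v UNIV \<le> real (card G) * (real m - b P + 1) + real (cnt G e ?a) * b P"
    proof (rule depth_upper[where u = "\<lambda>_. 0" and l = "2 * M / P"])
      have "\<bar>2 * V / P\<bar> = 2 * (V / P)" using v_last P4 by simp
      then show "\<bar>?a i\<bar> \<le> B" for i
        using V1 X B by (intro abs_\<tau>_le) linarith+
      show "2 * M / P * P \<le> K" using P4 M_le_K by simp
      have "2 * M / P \<le> 2 * M" using P4 M_ge by (simp add: field_simps)
      then show "2 * M / P \<le> K" using M_le_K by linarith
      show "M * (dot e ?a p + t * dot e ?a v) + (dot e (\<lambda>_. 0) p + t * dot e (\<lambda>_. 0) v)
          - 2 * M / P * xn t \<le> 0" for t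
        using P4 by (simp add: dot_def[of e "\<lambda>_. 0"] field_simps)
    qed (use P4 M_ge X in \<open>auto simp: dot_def[of e "\<lambda>_. 0"]\<close>)
    moreover have "{g \<in> G. dot e ?a g < 1} = {}"
    proof -
      have "dot e ?a g \<ge> 1" if "g \<in> G" for g
      proof -
        have "\<bar>dot e ?a g - 2\<bar> \<le> 2 * (V * X / P)"
          using dot_\<tau>_G[OF that, of 2 "2 * V / P"] v_last P4 by simp
        then show ?thesis using VX by linarith
      qed
      then show ?thesis by force
    qed
    then have "cnt G e ?a = 0" unfolding cnt_def by (simp only: card.empty)
    ultimately show ?thesis by (simp add: card_G_real)
  qed
  have up': "D p v S \<le> N * (real m - b P + 1)" for S
    using D_mono[of S UNIV] up by simp
  show ?thesis
  proof (rule line_bounds_stretchI)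
    show "(real e + 3) * D p v UNIV \<le> (2 * real m + (4 + 4 * C)) * N"
      by (rule whole_arith[where b = "b P" and a = "D' UNIV" and d = 0 and Y = Y])
        (use C low up bounds_Y scaled_Y in auto)
    fix q
    show "(real e + 2) * D p v {q..} + 2 * D p v {..q} \<le> (2 * real m + (8 + 6 * C)) * N \<and>
      (real e + 2) * D p v {..q} + 2 * D p v {q..} \<le> (2 * real m + (8 + 6 * C)) * N"
      using rays_near_arith[of "real e" "b P" N C "D p v {q..}" "real m" "D' {q..}" "D p v {..q}"
          "D' {..q}" 0 Y]
        C low up' bounds_Y(2,3)[of q] scaled_Y[of P] b_le D'_nonneg[of "{q..}"] D'_nonneg[of "{..q}"] by simp
  qed
qed

text \<open>The main case: the height is \<open>V * (t - z)\<close> with root \<open>z\<close> near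
  the grid, and \<open>V\<close> is the threshold. The correction \<open>u\<close> cancels
  \<open>t - z\<close>, and enlarging the last coefficient by \<open>M * s / V\<close> in absolute
  value adds or subtracts \<open>s * (t - z)\<close> in the projected functional.\<close>

lemma near:
  assumes P: "\<bar>P\<bar> < 2 * X * V" and V: "V > 1"
  shows "line_bounds (Suc e) (real e + 3) (8 + 6 * C) m G2 K p v"
proof -
  define z where "z = - P / V"
  have z: "\<bar>z\<bar> \<le> 2 * X" using P V by (simp add: z_def field_simps)
  have xn: "xn t = V * (t - z)" for t using V by (simp add: z_def field_simps)
  have slope: "(1 + M * s) / V * xn t = (t - z) + M * s * (t - z)" for s t
    unfolding xn using V by (simp add: field_simps)
  have MT: "M * s \<le> T" if "s = max 0 (dot e a v) \<or> s = max 0 (- dot e a v)"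
    "\<And>i. i \<le> e \<Longrightarrow> \<bar>a i\<bar> \<le> B" for s a
  proof -
    have "M * s \<le> M * \<bar>dot e a v\<bar>" using that(1) M_ge by (intro mult_left_mono) auto
    then show ?thesis using abs_slope_le[of a] v_le that(2) by force
  qed
  have low: "D p v S \<le> (b V + 1) * real (cnt G e a)"
    if a: "\<And>i. i \<le> e \<Longrightarrow> \<bar>a i\<bar> \<le> B" and s: "0 \<le> s" "M * s \<le> T"
      and S: "\<And>t. t \<in> S \<Longrightarrow> dot e a p + t * dot e a v + s * (t - z) \<le> 0" for S a s
  proof -
    have Ms: "0 \<le> M * s" using M_ge s by simp
    have "D p v S \<le> real (cnt G e a) * (b V + 1)"
    proof (rule depth_lower[where u = "\<tau> z (- 1)" and l = "(1 + M * s) / V"])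
      show "\<bar>a i\<bar> \<le> B" if "i \<le> e" for i using a that .
      show "\<bar>\<tau> z (- 1) i\<bar> \<le> 2 * X" for i using z X by (intro abs_\<tau>_le) auto
      show "\<bar>dot e (\<tau> z (- 1)) g\<bar> \<le> 3 * X" if "g \<in> G" for g
        using dot_\<tau>_G[OF that, of z "- 1"] z by (simp add: abs_mult)
      show "1 \<le> (1 + M * s) / V * V" using V Ms by simp
      have "(1 + M * s) / V \<le> 1 + M * s" using divide_left_mono[of 1 V "1 + M * s"] V Ms by simp
      then show "(1 + M * s) / V \<le> K" using s T_le_K by linarith
      fix t assume "t \<in> S"
      then have "M * (dot e a p + t * dot e a v + s * (t - z)) \<le> 0"
        using S M_ge by (simp add: mult_le_0_iff)
      then show "M * (dot e a p + t * dot e a v) + (dot e (\<tau> z (- 1)) p + t * dot e (\<tau> z (- 1)) v)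
          + (1 + M * s) / V * xn t \<le> 0"
        using slope[of s t] by (simp add: algebra_simps)
    qed (use V in auto)
    then show ?thesis by (simp add: mult.commute)
  qed
  have up: "D p v S \<le> N * (real m - b V + 1) + (b V + 1) * real (cnt G e a)"
    if a: "\<And>i. i \<le> e \<Longrightarrow> \<bar>a i\<bar> \<le> B" and s: "0 \<le> s" "M * s \<le> T"
      and S: "\<And>t. t \<in> S \<Longrightarrow> dot e a p + t * dot e a v - s * (t - z) \<le> 0" for S a s
  proof -
    have Ms: "0 \<le> M * s" using M_ge s by simp
    have "D p v S \<le> real (card G) * (real m - b V + 1) + real (cnt G e a) * b V"
    proof (rule depth_upper[where u = "\<tau> (- z) 1" and l = "(1 + M * s) / V"])
      show "\<bar>a i\<bar> \<le> B" if "i \<le> e" for i using a that .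
      show "\<bar>\<tau> (- z) 1 i\<bar> \<le> 2 * X" for i using z X by (intro abs_\<tau>_le) auto
      show "\<bar>dot e (\<tau> (- z) 1) g\<bar> \<le> 3 * X" if "g \<in> G" for g
        using dot_\<tau>_G[OF that, of "- z" 1] z by (simp add: abs_mult)
      show "(1 + M * s) / V * V \<le> K" using V s T_le_K by simp
      have "(1 + M * s) / V \<le> 1 + M * s" using divide_left_mono[of 1 V "1 + M * s"] V Ms by simp
      then show "(1 + M * s) / V \<le> K" using s T_le_K by linarith
      fix t assume "t \<in> S"
      then have "M * (dot e a p + t * dot e a v - s * (t - z)) \<le> 0"
        using S M_ge by (simp add: mult_le_0_iff)
      then show "M * (dot e a p + t * dot e a v) + (dot e (\<tau> (- z) 1) p + t * dot e (\<tau> (- z) 1) v)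
          - (1 + M * s) / V * xn t \<le> 0"
        using slope[of s t] by (simp add: algebra_simps)
    qed (use V Ms in auto)
    also have "real (cnt G e a) * b V \<le> (b V + 1) * real (cnt G e a)" by (simp add: algebra_simps)
    finally show ?thesis by (simp add: card_G_real)
  qed
  have low_all: "D p v S \<le> (b V + 1) * D' S" for S
  proof -
    obtain a where a: "\<And>i. i \<le> e \<Longrightarrow> \<bar>a i\<bar> \<le> B" "\<And>t. t \<in> S \<Longrightarrow> dot e a p + t * dot e a v \<le> 0"
      "real (cnt G e a) = D' S" using D'_attained[of S] by blast
    show ?thesis using low[of a 0 S] a(1,2) T_ge unfolding a(3) by simp
  qed
  \<comment> \<open>Feasibility above the root extends to all of \<open>S\<close>. If
    \<open>a\<close> has negative slope, \<open>s\<close> cancels it and leaves the constant value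
    at \<open>z\<close>; otherwise \<open>s = 0\<close> and the values below \<open>z\<close> are at
    most the value at \<open>z\<close>.\<close>
  have low_cut: "D p v S \<le> (b V + 1) * D' (S \<inter> {z..})" if zS: "z \<in> S" for S
  proof -
    obtain a where a: "\<And>i. i \<le> e \<Longrightarrow> \<bar>a i\<bar> \<le> B"
      "\<And>t. t \<in> S \<inter> {z..} \<Longrightarrow> dot e a p + t * dot e a v \<le> 0"
      "real (cnt G e a) = D' (S \<inter> {z..})" using D'_attained[of "S \<inter> {z..}"] by blast
    define s where "s = max 0 (- dot e a v)"
    have "dot e a p + t * dot e a v + s * (t - z) \<le> 0" if "t \<in> S" for t
    proof (cases "dot e a v \<ge> 0 \<and> t \<ge> z")
      case True
      then have "s = 0" by (simp add: s_def)
      then show ?thesis using True a(2)[of t] that by simp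
    next
      case False
      have "dot e a p + t * dot e a v + s * (t - z) = (dot e a p + z * dot e a v) + (dot e a v + s) * (t - z)"
        by (simp add: algebra_simps)
      moreover have "(dot e a v + s) * (t - z) \<le> 0"
        using False by (auto simp: s_def max_def mult_le_0_iff)
      ultimately show ?thesis using a(2)[of z] zS by simp
    qed
    then show ?thesis
      using low[of a s S] MT[of s a] a(1) unfolding a(3) by (simp add: s_def)
  qed
  \<comment> \<open>The mirror image: now \<open>s\<close> cancels a positive slope, and feasibility
    below the root is enough.\<close>
  have up_cut: "D p v S \<le> N * (real m - b V + 1) + (b V + 1) * D' (S \<inter> {..z})" if zS: "z \<in> S" for S
  proof -
    obtain a where a: "\<And>i. i \<le> e \<Longrightarrow> \<bar>a i\<bar> \<le> B"
      "\<And>t. t \<in> S \<inter> {..z} \<Longrightarrow> dot e a p + t * dot e a v \<le> 0"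
      "real (cnt G e a) = D' (S \<inter> {..z})" using D'_attained[of "S \<inter> {..z}"] by blast
    define s where "s = max 0 (dot e a v)"
    have "dot e a p + t * dot e a v - s * (t - z) \<le> 0" if "t \<in> S" for t
    proof (cases "dot e a v \<le> 0 \<and> t \<le> z")
      case True
      then have "s = 0" by (simp add: s_def)
      then show ?thesis using True a(2)[of t] that by simp
    next
      case False
      have "dot e a p + t * dot e a v - s * (t - z) = (dot e a p + z * dot e a v) + (dot e a v - s) * (t - z)"
        by (simp add: algebra_simps)
      moreover have "(dot e a v - s) * (t - z) \<le> 0"
        using False by (auto simp: s_def max_def mult_le_0_iff)
      ultimately show ?thesis using a(2)[of z] zS by simp
    qed
    then show ?thesis
      using up[of a s S] MT[of s a] a(1) unfolding a(3) by (simp add: s_def)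
  qed
  have whole: "(real e + 3) * D p v UNIV \<le> (2 * real m + (4 + 4 * C)) * N"
    by (rule whole_arith[where b = "b V" and a = "D' {z..}" and d = "D' {..z}" and Y = Y])
      (use C low_cut[of UNIV] up_cut[of UNIV] bounds_Y scaled_Y in auto)
  show ?thesis
  proof (rule line_bounds_stretchI[OF whole])
    fix q assume q: "xn q > 1"
    then have "V * (q - z) > 0" unfolding xn by linarith
    then have qz: "q > z" using V by (simp add: zero_less_mult_iff)
    show "(real e + 2) * D p v {q..} + 2 * D p v {..q} \<le> (2 * real m + (8 + 6 * C)) * N \<and>
      (real e + 2) * D p v {..q} + 2 * D p v {q..} \<le> (2 * real m + (8 + 6 * C)) * N"
    \<comment> \<open>Within distance \<open>1 / T\<close> of the root, the variation of a lifted
      functional is absorbed by the change of height, so the lower ray costs no more than its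
      endpoint. Farther away the height of \<open>q\<close> exceeds \<open>V / T\<close>.\<close>
    proof (cases "T * (q - z) \<le> 1")
      case True
      have "D p v {..q} \<le> (b (xn q) + 1) * D' {q}"
      proof (rule depth_point[where s = T])
        show "M * \<bar>dot e a v\<bar> \<le> T" if "\<And>i. i \<le> e \<Longrightarrow> \<bar>a i\<bar> \<le> B" for a
          using abs_slope_le[OF v_le that] .
        fix t assume t: "t \<in> {..q}"
        have "(T * (q - z)) * ((q - t) * V) \<le> 1 * ((q - t) * V)"
          using t V True by (intro mult_right_mono) auto
        then show "T * \<bar>t - q\<bar> * xn q \<le> xn q - xn t"
          unfolding xn using t by (simp add: algebra_simps abs_if)
      qed (use q in auto)
      then show ?thesis using whole q by (intro rays_close) auto
    next
      case False
      let ?R = "D p v {q..}" and ?L = "D p v {..q}"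
      have "{..q} \<inter> {z..} = {z..q}" "{..q} \<inter> {..z} = {..z}" using qz by auto
      then have L: "?L \<le> (b V + 1) * D' {z..q}" "?L \<le> N * (real m - b V + 1) + (b V + 1) * D' {..z}"
        using low_cut[of "{..q}"] up_cut[of "{..q}"] qz by simp_all
      \<comment> \<open>As \<open>M * T \<le> K\<close>, the height of \<open>q\<close> is close
        enough to \<open>V\<close> for \<open>V\<close> to remain the threshold in
        \<open>depth_top\<close>.\<close>
      have "M * V \<le> K * xn q"
      proof -
        have "1 * (M * V) \<le> (T * (q - z)) * (M * V)"
          using False V M_ge by (intro mult_right_mono) auto
        also have "\<dots> = (M * T) * xn q" unfolding xn by (simp add: algebra_simps)
        also have "\<dots> \<le> K * xn q" using MT_le_K q by (intro mult_right_mono) auto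
        finally show ?thesis by simp
      qed
      moreover have "M * 1 \<le> M * V" using M_ge V by (intro mult_left_mono) auto
      ultimately have "M \<le> K * xn q" "M * V \<le> K * xn q" by simp_all
      then have R: "?R \<le> N * (real m - b V + 1)"
        using q V by (intro depth_top[of "xn q"]) (auto intro: mult_right_mono)
      \<comment> \<open>The segment lies in the ray below \<open>q\<close> and in the ray above
        \<open>z\<close>, so the inequalities for complementary rays at \<open>q\<close> and at
        \<open>z\<close> apply to it.\<close>
      have c: "D' {z..q} \<le> D' {..q}" "D' {z..q} \<le> D' {z..}" by (auto intro: D'_mono)
      have "(real e + 1) * D' {z..q} \<le> (real e + 1) * D' {..q}"
        "(real e + 1) * D' {z..q} \<le> (real e + 1) * D' {z..}"
        using c by (auto intro: mult_left_mono)
      then have "(real e + 1) * D' {q..} + 2 * D' {z..q} \<le> Y"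
        "(real e + 1) * D' {z..q} + 2 * D' {q..} \<le> Y"
        "(real e + 1) * D' {z..q} + 2 * D' {..z} \<le> Y"
        using bounds_Y(2,3)[of q] bounds_Y(2)[of z] c by linarith+
      then show ?thesis
        using rays_near_arith[of "real e" "b V" N C ?R "real m" "D' {q..}" ?L "D' {z..q}" "D' {..z}" Y]
          C R L low_all[of "{q..}"] scaled_Y[of V] b_le by auto
    qed
  qed
qed

lemma line_bounds_normal: "line_bounds (Suc e) (real e + 3) (8 + 6 * C) m G2 K p v"
proof (cases "\<bar>P\<bar> \<le> 4 * X \<and> V \<le> 2")
  case True
  then show ?thesis by (intro line_bounds_zero small) auto
next
  case not_small: False
  show ?thesis
  proof (cases "2 * X * V \<le> \<bar>P\<bar>")
    case True
    have "4 * X \<le> \<bar>P\<bar>"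
    proof (cases "V \<le> 2")
      case False
      then have "2 * X * 2 \<le> 2 * X * V" using X by (intro mult_left_mono) auto
      then show ?thesis using True by linarith
    qed (use not_small in auto)
    then consider "4 * X \<le> P" | "P \<le> - (4 * X)" by linarith
    then show ?thesis
    proof cases
      case 1
      then show ?thesis using True X by (intro far_pos) auto
    next
      case 2
      show ?thesis by (rule line_bounds_zero[OF far_neg[OF True 2]])
    qed
  next
    case False
    have "V > 1"
    proof (rule ccontr)
      assume "\<not> V > 1"
      then have "2 * X * V \<le> 2 * X * 1" using X by (intro mult_left_mono) auto
      then have "\<bar>P\<bar> \<le> 4 * X" using False X by linarith
      then show False using not_small \<open>\<not> V > 1\<close> by linarith
    qed
    then show ?thesis using False by (intro near) auto
  qed
qed

end

section \<open>Induction on the dimension\<close>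

lemma grid_bounds_step:
  assumes e: "e \<ge> 1" and m: "m \<ge> 1" and C: "C \<ge> 0"
    and G: "grid_bounds e (real e + 1) C m G B'"
  shows "\<exists>G2 K. grid_bounds (Suc e) (real e + 3) (8 + 6 * C) m G2 K"
proof -
  have fin: "finite G" and card: "card G = m ^ e" and B': "B' \<ge> 0"
    and supp: "\<And>g. g \<in> G \<Longrightarrow> g 0 = 1" "\<And>g i. g \<in> G \<Longrightarrow> i > e \<Longrightarrow> g i = 0"
    and lines: "\<And>p v. p 0 = 1 \<Longrightarrow> v 0 = 0 \<Longrightarrow> line_bounds e (real e + 1) C m G B' p v"
    using G by (auto simp: grid_bounds_def)
  define X where "X = 1 + (\<Sum>g\<in>G. \<Sum>i\<le>e. \<bar>g i\<bar>)"
  define B where "B = max B' (2 * X)"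
  define M where "M = 3 * X + 2"
  define T where "T = M * (real e + 1) * B"
  \<comment> \<open>All lower bounds required of \<open>K\<close> are nonnegative, so their sum
    meets each of them, independently of the line.\<close>
  define K where "K = (M * B + 2 * X) + (T * X + 3 * X + 1) + (M * T + T + 2 * M) + 8 * X"
  have X: "X \<ge> 1" by (auto simp: X_def intro!: sum_nonneg)
  have pos: "B \<ge> 0" "M \<ge> 0" "T \<ge> 0" using X by (auto simp: B_def M_def T_def)
  interpret stretching e m G B X M T K
  proof
    fix g i assume g: "g \<in> G" "i \<le> e"
    have "\<bar>g i\<bar> \<le> (\<Sum>i\<le>e. \<bar>g i\<bar>)"
      using g by (intro member_le_sum[of _ "{..e}" "\<lambda>i. \<bar>g i\<bar>"]) auto
    also have "\<dots> \<le> (\<Sum>g\<in>G. \<Sum>i\<le>e. \<bar>g i\<bar>)"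
      using g fin by (intro member_le_sum[of _ G "\<lambda>g. \<Sum>i\<le>e. \<bar>g i\<bar>"]) (auto intro: sum_nonneg)
    finally show "\<bar>g i\<bar> \<le> X" by (simp add: X_def)
  next
    have nn: "0 \<le> M * B" "0 \<le> T * X" "0 \<le> M * T" using pos X by auto
    show "M * B + 2 * X \<le> K" "T * X + 3 * X + 1 \<le> K" "M * T + T + 2 * M \<le> K" "8 * X \<le> K"
      unfolding K_def using pos X nn by linarith+
  qed (use e fin supp X in \<open>auto simp: B_def M_def T_def\<close>)
  have "line_bounds (Suc e) (real e + 3) (8 + 6 * C) m G2 K p v"
    if p0: "p 0 = 1" and v0: "v 0 = 0" for p v
  proof -
    \<comment> \<open>The sign that makes the new coordinate nondecreasing along the line.\<close>
    define d where "d = (if v (Suc e) \<ge> 0 then 1 else - 1 :: real)"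
    show ?thesis
    proof (cases "\<forall>i\<le>e. v i = 0")
      case True
      have "stretching_line e m G B X M T K C B' (\<lambda>i. p i + 0 * v i) (\<lambda>i. d * v i)"
        using m card C B' p0 v0 by unfold_locales (auto simp: B_def d_def intro: lines)
      then show ?thesis
        using stretching_line.line_bounds_vertical True
        by (intro line_bounds_reparam[of d _ _ _ _ _ _ p 0 v]) (auto simp: d_def)
    next
      case False
      obtain k where k: "k \<le> e" "\<And>i. i \<le> e \<Longrightarrow> \<bar>v i\<bar> \<le> \<bar>v k\<bar>"
      proof -
        obtain k where "is_arg_min (\<lambda>i. - \<bar>v i\<bar>) (\<lambda>i. i \<in> {..e}) k"
          using ex_is_arg_min_if_finite[of "{..e}" "\<lambda>i. - \<bar>v i\<bar>"] by blast
        then show thesis using that[of k] by (auto simp: is_arg_min_linorder)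
      qed
      have vk: "\<bar>v k\<bar> > 0"
      proof -
        obtain i where "i \<le> e" "v i \<noteq> 0" using False by blast
        then show ?thesis using k(2)[of i] by linarith
      qed
      \<comment> \<open>This scaling makes the largest entry of the projected direction a sign;
        \<open>c\<close> moves the base point to where coordinate \<open>k\<close> vanishes.\<close>
      define r where "r = d / \<bar>v k\<bar>"
      define c where "c = - p k / v k"
      have r: "r \<noteq> 0" "\<bar>r\<bar> = 1 / \<bar>v k\<bar>" using vk by (auto simp: r_def d_def abs_divide)
      have rv: "r * v (Suc e) \<ge> 0" using vk by (auto simp: r_def d_def)
      have "normal_line e m G B X M T K C B' (\<lambda>i. p i + c * v i) (\<lambda>i. r * v i) k"
      proof
        show "line_bounds e (real e + 1) C m G B' (\<lambda>i. p i + c * v i) (\<lambda>i. r * v i)"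
          by (rule lines) (simp_all add: p0 v0)
        show "\<bar>r * v i\<bar> \<le> 1" if "i \<le> e" for i
          using k(2)[OF that] vk by (simp add: abs_mult r)
      qed (use m card C B' p0 v0 rv k r vk in \<open>auto simp: B_def abs_mult c_def\<close>)
      then show ?thesis
        using normal_line.line_bounds_normal r(1) by (intro line_bounds_reparam[of r _ _ _ _ _ _ p c v]) auto
    qed
  qed
  moreover have "card G2 = m ^ Suc e"
    using card_stretch[of G e K m] supp(2) K_ge card by simp
  moreover have "\<forall>g\<in>G2. g 0 = 1 \<and> (\<forall>i>Suc e. g i = 0)"
    using supp by (auto simp: stretch_def)
  ultimately show ?thesis
    unfolding grid_bounds_def using finite_stretch[OF fin] K_ge by (intro exI[of _ G2] exI[of _ K]) auto
qed

lemma grid_bounds_mono: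
  assumes "grid_bounds e c C m G B" "c' \<le> c"
  shows "grid_bounds e c' C m G B"
proof -
  have "c' * depth G e B p v UNIV \<le> c * depth G e B p v UNIV" for p v
    using assms(2) by (intro mult_right_mono) (auto simp: depth_def)
  then show ?thesis
    using assms(1) unfolding grid_bounds_def line_bounds_def by (meson order_trans)
qed

text \<open>Of the constant \<open>e + 3\<close> given by the step only \<open>e + 2\<close> is
  passed on, to match the weaker constant of dimension 1.\<close>

lemma ex_grid_bounds:
  assumes "e \<ge> 1"
  shows "\<exists>C\<ge>0. \<forall>m\<ge>1. \<exists>G B. grid_bounds e (real e + 1) C m G B"
  using assms
proof (induction e rule: nat_induct_at_least)
  case base
  then show ?case
    using grid_bounds_base by (intro exI[of _ 4]) fastforce
next
  case (Suc e)
  then obtain C where C: "C \<ge> 0" "\<And>m. m \<ge> 1 \<Longrightarrow> \<exists>G B. grid_bounds e (real e + 1) C m G B"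
    by blast
  have "\<exists>G B. grid_bounds (Suc e) (real (Suc e) + 1) (8 + 6 * C) m G B" if m: "m \<ge> 1" for m
  proof -
    obtain G B where "grid_bounds e (real e + 1) C m G B" using C(2)[OF m] by blast
    from grid_bounds_step[OF Suc(1) m C(1) this]
    obtain G2 K where "grid_bounds (Suc e) (real e + 3) (8 + 6 * C) m G2 K" by blast
    then have "grid_bounds (Suc e) (real (Suc e) + 1) (8 + 6 * C) m G2 K"
      by (rule grid_bounds_mono) simp
    then show ?thesis by blast
  qed
  then show ?case using C(1) by (intro exI[of _ "8 + 6 * C"]) auto
qed

text \<open>The last step keeps the full constant \<open>e + 3 = d + 2\<close>, the denominator of
  the theorem.\<close>

lemma ex_grid_bounds_line:
  assumes "d \<ge> 2"
  shows "\<exists>C\<ge>0. \<forall>m\<ge>1. \<exists>G B. grid_bounds d (real d + 2) C m G B"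
proof -
  obtain e where e: "d = Suc e" "e \<ge> 1" using assms by (cases d) auto
  obtain C where C: "C \<ge> 0" "\<And>m. m \<ge> 1 \<Longrightarrow> \<exists>G B. grid_bounds e (real e + 1) C m G B"
    using ex_grid_bounds[OF e(2)] by blast
  have "\<exists>G B. grid_bounds d (real d + 2) (8 + 6 * C) m G B" if m: "m \<ge> 1" for m
  proof -
    obtain G B where "grid_bounds e (real e + 1) C m G B" using C(2)[OF m] by blast
    from grid_bounds_step[OF e(2) m C(1) this] show ?thesis
      by (simp add: e(1) add.commute)
  qed
  then show ?thesis using C(1) by (intro exI[of _ "8 + 6 * C"]) auto
qed

section \<open>Transfer to Euclidean space and to an arbitrary number of points\<close>

lemma line_parametrization:
  fixes L :: "'a::euclidean_space set"
  assumes "line L"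
  obtains P v where "\<And>x. x \<in> L \<Longrightarrow> \<exists>t. x = P + t *\<^sub>R v"
proof -
  obtain b where b: "affine hull b = affine hull L" "of_nat (card b) = aff_dim L + 1"
    using aff_dim_basis_exists[of L] by blast
  then have "card b = 2" using assms by (simp add: line_def)
  then obtain x y where xy: "b = {x, y}" by (auto simp: card_2_iff)
  have "L = affine hull {x, y}"
    using b(1) assms xy by (simp add: line_def affine_hull_eq[THEN iffD2])
  then have "\<exists>t. z = x + t *\<^sub>R (y - x)" if "z \<in> L" for z
    using that by (auto simp: affine_hull_2_alt)
  then show thesis using that by blast
qed

text \<open>Coordinate \<open>0\<close> turns into the constant term of the inequality of a
  halfspace. Grid points in the halfspace have value at most \<open>0\<close>, hence are among those
  counted by \<open>cnt\<close>.\<close>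

lemma grid_in_space:
  assumes d: "CARD('d::finite) = d" "d \<ge> 2"
    and G: "grid_bounds d (real d + 2) C m G B"
  shows "\<exists>F :: (real ^ 'd) set. finite F \<and> card F = m ^ d \<and>
    (\<forall>L. line L \<longrightarrow> (\<exists>H. closed_halfspace H \<and> L \<subseteq> H \<and>
      (real d + 2) * real (card (F \<inter> H)) \<le> (2 * real m + C) * real m ^ (d - 1)))"
proof -
  have fin: "finite G" and card: "card G = m ^ d" and B: "B \<ge> 0"
    and supp: "\<And>g. g \<in> G \<Longrightarrow> g 0 = 1" "\<And>g i. g \<in> G \<Longrightarrow> i > d \<Longrightarrow> g i = 0"
    and lines: "\<And>p v. p 0 = 1 \<Longrightarrow> v 0 = 0 \<Longrightarrow> line_bounds d (real d + 2) C m G B p v"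
    using G by (auto simp: grid_bounds_def)
  obtain f :: "'d \<Rightarrow> nat" where f: "bij_betw f UNIV {1..d}"
    using ex_bij_betw_nat_finite_1[of "UNIV :: 'd set"] d(1) bij_betw_inv by fastforce
  have dot_vec: "dot d a x = a 0 * x 0 + (\<chi> i. a (f i)) \<bullet> (\<chi> i. x (f i))" for a x
  proof -
    have "dot d a x = a 0 * x 0 + (\<Sum>j\<in>{1..d}. a j * x j)"
      unfolding dot_def atMost_atLeast0 by (simp add: sum.atLeast_Suc_atMost)
    also have "(\<Sum>j\<in>{1..d}. a j * x j) = (\<Sum>i\<in>UNIV. a (f i) * x (f i))"
      by (rule sum.reindex_bij_betw[OF f, symmetric])
    finally show ?thesis by (simp add: inner_vec_def)
  qed
  define vec where "vec g = (\<chi> i. g (f i))" for g :: "nat \<Rightarrow> real"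
  have inj: "inj_on vec G"
  proof (rule inj_onI)
    fix g h assume gh: "g \<in> G" "h \<in> G" "vec g = vec h"
    show "g = h"
    proof
      fix j
      consider "j = 0" | "j > d" | i where "j = f i"
        using f by (metis atLeastAtMost_iff bij_betw_def imageE less_one not_le)
      then show "g j = h j"
      proof cases
        case 3
        then show ?thesis using gh(3) by (simp add: vec_def vec_eq_iff)
      qed (simp_all add: supp(1)[OF gh(1)] supp(1)[OF gh(2)] supp(2)[OF gh(1)] supp(2)[OF gh(2)])
    qed
  qed
  have "\<exists>H. closed_halfspace H \<and> L \<subseteq> H \<and>
      (real d + 2) * real (card (vec ` G \<inter> H)) \<le> (2 * real m + C) * real m ^ (d - 1)"
    if L: "line L" for L
  proof -
    obtain P v where Pv: "\<And>x. x \<in> L \<Longrightarrow> \<exists>t. x = P + t *\<^sub>R v"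
      using line_parametrization[OF L] by blast
    \<comment> \<open>Homogeneous coordinates: \<open>c = 1\<close> for points, \<open>c = 0\<close>
      for directions.\<close>
    define g where "g c x = (\<lambda>j. if j = 0 then c else x $ inv f j)" for c :: real and x :: "real ^ 'd"
    have f0: "f i \<noteq> 0" for i
    proof -
      have "f i \<in> {1..d}" using bij_betwE[OF f] by blast
      then show ?thesis by simp
    qed
    have inv: "inv f (f i) = i" for i using f by (simp add: bij_betw_def)
    obtain a where a: "feasible d B (g 1 P) (g 0 v) UNIV a"
      and cnt: "real (cnt G d a) = depth G d B (g 1 P) (g 0 v) UNIV"
      by (rule depth_attained[OF B])
    have bound: "(real d + 2) * real (cnt G d a) \<le> (2 * real m + C) * real m ^ (d - 1)"
      unfolding cnt using lines[of "g 1 P" "g 0 v"] by (simp add: g_def line_bounds_def)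
    define w where "w = (\<chi> i. a (f i))"
    have dot_g: "dot d a (g c x) = a 0 * c + w \<bullet> x" for c x
      unfolding dot_vec w_def by (simp add: g_def f0 inv)
    have le: "a 0 + w \<bullet> (P + t *\<^sub>R v) \<le> 0" for t
    proof -
      have "(a 0 * 1 + w \<bullet> P) + t * (a 0 * 0 + w \<bullet> v) \<le> 0"
        using a unfolding feasible_def dot_g by blast
      then show ?thesis by (simp add: inner_add_right algebra_simps)
    qed
    have card_le: "card (vec ` G \<inter> H) \<le> cnt G d a"
      if "\<And>x. x \<in> G \<Longrightarrow> vec x \<in> H \<Longrightarrow> dot d a x < 1" for H
    proof -
      have "vec ` G \<inter> H \<subseteq> vec ` {x \<in> G. dot d a x < 1}" using that by auto
      then have "card (vec ` G \<inter> H) \<le> card (vec ` {x \<in> G. dot d a x < 1})"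
        using fin by (intro card_mono) auto
      also have "\<dots> \<le> cnt G d a"
        unfolding cnt_def using fin by (intro card_image_le) auto
      finally show ?thesis .
    qed
    have "\<exists>H. closed_halfspace H \<and> L \<subseteq> H \<and> card (vec ` G \<inter> H) \<le> cnt G d a"
    proof (cases "w = 0")
      case False
      let ?H = "{x. w \<bullet> x \<le> - a 0}"
      have "closed_halfspace ?H" using False by (auto simp: closed_halfspace_def)
      moreover have "L \<subseteq> ?H"
      proof
        fix x assume "x \<in> L"
        then obtain t where "x = P + t *\<^sub>R v" using Pv by blast
        then show "x \<in> ?H" using le[of t] by simp
      qed
      moreover have "card (vec ` G \<inter> ?H) \<le> cnt G d a"
      proof (rule card_le)
        fix x assume "x \<in> G" "vec x \<in> ?H"
        then show "dot d a x < 1" using supp(1)[of x] by (simp add: dot_vec vec_def w_def)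
      qed
      ultimately show ?thesis by blast
    next
      \<comment> \<open>The functional is a nonpositive constant and counts all of \<open>G\<close>,
        so any halfspace containing the line will do; \<open>d \<ge> 2\<close> provides a normal
        vector orthogonal to it.\<close>
      case True
      have "2 \<le> DIM(real ^ 'd)" using d by simp
      then obtain y where y: "y \<noteq> 0" "orthogonal v y"
        by (rule orthogonal_to_vector_exists)
      let ?H = "{x. y \<bullet> x \<le> y \<bullet> P}"
      have "closed_halfspace ?H" using y by (auto simp: closed_halfspace_def)
      moreover have "L \<subseteq> ?H"
      proof
        fix x assume "x \<in> L"
        then obtain t where "x = P + t *\<^sub>R v" using Pv by blast
        then show "x \<in> ?H" using y by (simp add: inner_add_right orthogonal_def inner_commute)
      qed
      moreover have "card (vec ` G \<inter> ?H) \<le> cnt G d a"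
      proof (rule card_le)
        fix x assume "x \<in> G"
        then show "dot d a x < 1" using le[of 0] True supp(1)[of x] by (simp add: dot_vec flip: w_def)
      qed
      ultimately show ?thesis by blast
    qed
    then obtain H where H: "closed_halfspace H" "L \<subseteq> H" "card (vec ` G \<inter> H) \<le> cnt G d a" by blast
    have "(real d + 2) * real (card (vec ` G \<inter> H)) \<le> (real d + 2) * real (cnt G d a)"
      using H(3) by (intro mult_left_mono) auto
    from this bound have "(real d + 2) * real (card (vec ` G \<inter> H)) \<le> (2 * real m + C) * real m ^ (d - 1)"
      by (rule order_trans)
    with H(1,2) show ?thesis by blast
  qed
  moreover have "finite (vec ` G)" using fin by simp
  moreover have "card (vec ` G) = m ^ d" using card_image[OF inj] card by simp
  ultimately show ?thesis by blast
qed

theorem theorem1p1: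
  assumes "CARD('d::finite) \<ge> 2"
  shows "\<exists>g :: nat \<Rightarrow> real. (\<lambda>n. g n / real n) \<longlonglongrightarrow> 0 \<and>
    (\<forall>n. \<exists>G :: (real ^ 'd) set. finite G \<and> card G = n \<and>
      (\<forall>L. line L \<longrightarrow>
        (\<exists>H. closed_halfspace H \<and> L \<subseteq> H \<and>
          real (card (G \<inter> H)) \<le> 2 * real n / (real CARD('d) + 2) + g n)))"
proof -
  define d where "d = CARD('d)"
  have d: "d \<ge> 2" using assms by (simp add: d_def)
  obtain C where C: "C \<ge> 0" and "\<And>m. m \<ge> 1 \<Longrightarrow> \<exists>G B. grid_bounds d (real d + 2) C m G B"
    using ex_grid_bounds_line[OF d] by blast
  then have grid: "\<exists>F :: (real ^ 'd) set. finite F \<and> card F = m ^ d \<and>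
    (\<forall>L. line L \<longrightarrow> (\<exists>H. closed_halfspace H \<and> L \<subseteq> H \<and>
      (real d + 2) * real (card (F \<inter> H)) \<le> (2 * real m + C) * real m ^ (d - 1)))" if "m \<ge> 1" for m
    using grid_in_space[OF d_def[symmetric] d] that by blast
  define r where "r n = root d (real n)" for n
  \<comment> \<open>The grid has side length the integer part \<open>m\<close> of
    \<open>r n\<close>. The first term covers its error, and \<open>n - (r n - 1) ^ d\<close> bounds
    the number of points added to the grid to reach \<open>n\<close>, since
    \<open>m \<ge> r n - 1\<close>.\<close>
  define g where "g n = (if n = 0 then 0 else C * r n ^ (d - 1) + real n - (r n - 1) ^ d)" for n
  have r_pow: "r n ^ d = real n" for n using d by (simp add: r_def)
  have "(\<lambda>n. g n / real n) \<longlonglongrightarrow> 0"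
  proof -
    have "(\<lambda>n. root d (inverse (real n))) \<longlonglongrightarrow> root d 0"
      by (intro tendsto_real_root lim_inverse_n)
    then have inv: "(\<lambda>n. inverse (r n)) \<longlonglongrightarrow> 0"
      using d by (simp add: r_def real_root_inverse)
    have "(\<lambda>n. C * inverse (r n) + 1 - (1 - inverse (r n)) ^ d) \<longlonglongrightarrow> C * 0 + 1 - (1 - 0) ^ d"
      by (intro tendsto_intros inv)
    moreover have "eventually (\<lambda>n. C * inverse (r n) + 1 - (1 - inverse (r n)) ^ d = g n / real n) sequentially"
      using eventually_gt_at_top[of 0]
    proof eventually_elim
      case (elim n)
      then have r: "r n > 0" using d by (simp add: r_def)
      have 1: "r n ^ d = r n * r n ^ (d - 1)" using d by (cases d) auto
      have "1 - inverse (r n) = (r n - 1) / r n" using r by (simp add: field_simps)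
      then have "(1 - inverse (r n)) ^ d = (r n - 1) ^ d / r n ^ d"
        by (simp only: power_divide)
      moreover have "C * inverse (r n) = C * r n ^ (d - 1) / r n ^ d"
        unfolding 1 using r by (simp add: field_simps)
      ultimately show ?case
        using elim unfolding g_def r_pow by (simp add: diff_divide_distrib add_divide_distrib)
    qed
    ultimately show ?thesis by (simp add: tendsto_cong)
  qed
  moreover have "\<exists>G :: (real ^ 'd) set. finite G \<and> card G = n \<and>
      (\<forall>L. line L \<longrightarrow>
        (\<exists>H. closed_halfspace H \<and> L \<subseteq> H \<and>
          real (card (G \<inter> H)) \<le> 2 * real n / (real CARD('d) + 2) + g n))" for n
  proof (cases "n = 0")
    case True
    have "\<exists>H. closed_halfspace H \<and> L \<subseteq> H" if "line L" for L :: "(real ^ 'd) set"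
      \<comment> \<open>For the empty set only some halfspace containing the line is wanted; the
        one-point grid supplies it.\<close>
      using grid[of 1] that by auto
    then show ?thesis using True by (intro exI[of _ "{}"]) (simp add: g_def)
  next
    case False
    define m where "m = nat \<lfloor>r n\<rfloor>"
    have r1: "r n \<ge> 1" using False d by (simp add: r_def)
    have m: "m \<ge> 1" "real m \<le> r n" "r n - 1 \<le> real m"
      using r1 by (auto simp: m_def le_nat_floor)
    have "real m ^ d \<le> r n ^ d" using m by (intro power_mono) auto
    then have mn: "m ^ d \<le> n" unfolding r_pow by (simp flip: of_nat_power)
    obtain F :: "(real ^ 'd) set" where F: "finite F" "card F = m ^ d"
      and lines: "\<And>L. line L \<Longrightarrow> \<exists>H. closed_halfspace H \<and> L \<subseteq> H \<and>
        (real d + 2) * real (card (F \<inter> H)) \<le> (2 * real m + C) * real m ^ (d - 1)"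
      using grid[OF m(1)] by blast
    have "infinite (UNIV :: (real ^ 'd) set)"
      using finite_imp_bounded not_bounded_UNIV by blast
    then have "infinite (- F)" using F(1) by (simp add: Compl_eq_Diff_UNIV)
    then obtain R where R: "finite R" "card R = n - m ^ d" "R \<subseteq> - F"
      using infinite_arbitrarily_large by blast
    have "\<exists>H. closed_halfspace H \<and> L \<subseteq> H \<and>
        real (card ((F \<union> R) \<inter> H)) \<le> 2 * real n / (real CARD('d) + 2) + g n" if "line L" for L
    proof -
      obtain H where H: "closed_halfspace H" "L \<subseteq> H"
        "(real d + 2) * real (card (F \<inter> H)) \<le> (2 * real m + C) * real m ^ (d - 1)"
        using lines[OF \<open>line L\<close>] by blast
      have md: "real m ^ d = real m * real m ^ (d - 1)" using d by (cases d) auto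
      have "real m ^ (d - 1) \<le> r n ^ (d - 1)" using m by (intro power_mono) auto
      then have "C * real m ^ (d - 1) \<le> C * r n ^ (d - 1)" using C by (intro mult_left_mono)
      moreover have "C * real m ^ (d - 1) / (real d + 2) \<le> C * real m ^ (d - 1)"
        using C by (simp add: field_simps)
      moreover have "real (card (F \<inter> H)) \<le> (2 * real m + C) * real m ^ (d - 1) / (real d + 2)"
        using H(3) by (simp add: field_simps)
      then have "real (card (F \<inter> H)) \<le> 2 * real m ^ d / (real d + 2) + C * real m ^ (d - 1) / (real d + 2)"
        unfolding md by (simp add: algebra_simps add_divide_distrib)
      moreover have "2 * real m ^ d / (real d + 2) \<le> 2 * real n / (real d + 2)"
        using mn by (intro divide_right_mono) (auto simp flip: of_nat_power)
      moreover have "card ((F \<union> R) \<inter> H) \<le> card (F \<inter> H) + card (R \<inter> H)"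
        unfolding Int_Un_distrib2 by (rule card_Un_le)
      moreover have "card (R \<inter> H) \<le> n - m ^ d"
        unfolding R(2)[symmetric] by (rule card_mono) (use R in auto)
      moreover have "(r n - 1) ^ d \<le> real m ^ d" using r1 m by (intro power_mono) auto
      moreover have "real (n - m ^ d) = real n - real m ^ d" using mn by (simp add: of_nat_diff)
      ultimately have "real (card ((F \<union> R) \<inter> H)) \<le> 2 * real n / (real d + 2) + g n"
        using False unfolding g_def by simp
      then show ?thesis using H unfolding d_def by blast
    qed
    moreover have "card (F \<union> R) = n"
      using F R mn by (subst card_Un_disjoint) auto
    ultimately show ?thesis using F(1) R(1) by (intro exI[of _ "F \<union> R"]) simp
  qed
  ultimately show ?thesis by blast
qed

end
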